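(* Assume the Continuum Hypothesis fails. Then for every valuation domain $R$ of cardinality $\aleph_1$ and every type $J/R$ such that $\Gamma(J/R)\neq 0$, there is a non-standard uniserial $R$-module of type $J/R$.
   Context: A valuation domain is an integral domain whose ideals are linearly ordered; $Q$ its quotient field. A module is uniserial if its submodules are linearly ordered; a uniserial $R$-module is standard if isomorphic to $J'/A$ for $R$-submodules $A\subseteq J'$ of $Q$, non-standard otherwise. For uniserial $U$ and $0\neq a\in U$, $\mathrm{Ann}(a)=\{r:ra=0\}$, $D(a)=\bigcup\{r^{-1}R:a\in rU\}$; $U$ has type $J/A$ if $J/A\cong D(a)/\mathrm{Ann}(a)$. A type $J/R$ is given by an $R$-submodule $J$ of $Q$ with $R\subseteq J$; write $J=\bigcup_{\sigma<\omega_1} r_\sigma^{-1}R$ with nonzero $r_\sigma\in R$, $r_\tau\mid r_\sigma$ for $\tau<\sigma$. A cub is a closed unbounded subset of $\omega_1$; $D(\omega_1)$ is ${\cal P}(\omega_1)$ modulo $S_1\sim S_2$ iff $S_1\cap C=S_2\cap C$ for some cub $C$, a Boolean algebra whose $0$ is the class of sets disjoint from a cub and whose $1$ is the class of sets containing a cub. $\Gamma(J/R)$ is the class of $S=\{\delta<\omega_1\text{ limit}: R/\bigcap_{\sigma<\delta}r_\sigma R\text{ is not complete}\}$, where $R/\bigcap_{\sigma<\delta}r_\sigma R$ carries the metrizable linear topology with basis of neighbourhoods of $0$ given by the images of $r_\sigma R$, $\sigma<\delta$. This is independent of the choice of the $r_\sigma$. *)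

theory Defs
  imports Complex_Main "HOL-Computational_Algebra.Fraction_Field"
    "HOL-Library.Equipollence" "HOL-Library.Countable_Set"
begin

definition is_ideal :: "'r::idom set \<Rightarrow> bool" where
  "is_ideal I \<longleftrightarrow> 0 \<in> I \<and> (\<forall>x\<in>I. \<forall>y\<in>I. x + y \<in> I) \<and> (\<forall>r. \<forall>x\<in>I. r * x \<in> I)"

definition valuation_domain :: "'r::idom itself \<Rightarrow> bool" where
  "valuation_domain _ \<longleftrightarrow>
     (\<forall>I J :: 'r set. is_ideal I \<and> is_ideal J \<longrightarrow> I \<subseteq> J \<or> J \<subseteq> I)"

definition emb :: "'r::idom \<Rightarrow> 'r fract" where
  "emb r = Fraction_Field.Fract r 1"

definition Rset :: "'r::idom fract set" where
  "Rset = range emb"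

definition invR :: "'r::idom \<Rightarrow> 'r fract set" where
  "invR r = {Fraction_Field.Fract s r | s. True}"

definition Q_submodule :: "'r::idom fract set \<Rightarrow> bool" where
  "Q_submodule S \<longleftrightarrow> 0 \<in> S \<and> (\<forall>x\<in>S. \<forall>y\<in>S. x + y \<in> S)
      \<and> (\<forall>r. \<forall>x\<in>S. emb r * x \<in> S)"

text \<open>X/Y isomorphic to X'/Y' (Y a submodule of X, Y' of X', all in Q):
  there is an R-homomorphism from X onto X'/Y' with kernel Y,
  given by a map of representatives.\<close>
definition quot_iso :: "'r::idom fract set \<Rightarrow> 'r fract set \<Rightarrow> 'r fract set \<Rightarrow> 'r fract set \<Rightarrow> bool" where
  "quot_iso X Y X' Y' \<longleftrightarrow> (\<exists>f.
      (\<forall>x\<in>X. f x \<in> X')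
    \<and> (\<forall>x\<in>X. \<forall>y\<in>X. f (x + y) - (f x + f y) \<in> Y')
    \<and> (\<forall>r. \<forall>x\<in>X. f (emb r * x) - emb r * f x \<in> Y')
    \<and> (\<forall>x\<in>X. f x \<in> Y' \<longleftrightarrow> x \<in> Y)
    \<and> (\<forall>x'\<in>X'. \<exists>x\<in>X. f x - x' \<in> Y'))"

definition is_module :: "'m set \<Rightarrow> ('m \<Rightarrow> 'm \<Rightarrow> 'm) \<Rightarrow> 'm \<Rightarrow> ('r::idom \<Rightarrow> 'm \<Rightarrow> 'm) \<Rightarrow> bool" where
  "is_module M add z sm \<longleftrightarrow>
      z \<in> M \<and> (\<forall>x\<in>M. \<forall>y\<in>M. add x y \<in> M) \<and> (\<forall>r. \<forall>x\<in>M. sm r x \<in> M)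
    \<and> (\<forall>x\<in>M. \<forall>y\<in>M. \<forall>w\<in>M. add (add x y) w = add x (add y w))
    \<and> (\<forall>x\<in>M. \<forall>y\<in>M. add x y = add y x)
    \<and> (\<forall>x\<in>M. add z x = x)
    \<and> (\<forall>x\<in>M. \<exists>y\<in>M. add x y = z)
    \<and> (\<forall>r. \<forall>x\<in>M. \<forall>y\<in>M. sm r (add x y) = add (sm r x) (sm r y))
    \<and> (\<forall>r s. \<forall>x\<in>M. sm (r + s) x = add (sm r x) (sm s x))
    \<and> (\<forall>r s. \<forall>x\<in>M. sm (r * s) x = sm r (sm s x))
    \<and> (\<forall>x\<in>M. sm 1 x = x)"

definition submodule :: "'m set \<Rightarrow> 'm set \<Rightarrow> ('m \<Rightarrow> 'm \<Rightarrow> 'm) \<Rightarrow> 'm \<Rightarrow> ('r::idom \<Rightarrow> 'm \<Rightarrow> 'm) \<Rightarrow> bool" where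
  "submodule N M add z sm \<longleftrightarrow> N \<subseteq> M \<and> z \<in> N \<and> (\<forall>x\<in>N. \<forall>y\<in>N. add x y \<in> N)
      \<and> (\<forall>r. \<forall>x\<in>N. sm r x \<in> N)"

definition uniserial :: "'m set \<Rightarrow> ('m \<Rightarrow> 'm \<Rightarrow> 'm) \<Rightarrow> 'm \<Rightarrow> ('r::idom \<Rightarrow> 'm \<Rightarrow> 'm) \<Rightarrow> bool" where
  "uniserial M add z sm \<longleftrightarrow> is_module M add z sm \<and>
     (\<forall>N1 N2. submodule N1 M add z sm \<and> submodule N2 M add z sm \<longrightarrow> N1 \<subseteq> N2 \<or> N2 \<subseteq> N1)"

text \<open>standard: isomorphic to J'/A for R-submodules A \<subseteq> J' of Q, i.e. there is a
  surjective R-homomorphism J' \<rightarrow> M with kernel A.\<close>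
definition standard :: "'m set \<Rightarrow> ('m \<Rightarrow> 'm \<Rightarrow> 'm) \<Rightarrow> 'm \<Rightarrow> ('r::idom \<Rightarrow> 'm \<Rightarrow> 'm) \<Rightarrow> bool" where
  "standard M add z sm \<longleftrightarrow> (\<exists>J' A (f :: 'r fract \<Rightarrow> 'm).
      Q_submodule J' \<and> Q_submodule A \<and> A \<subseteq> J'
    \<and> (\<forall>x\<in>J'. f x \<in> M)
    \<and> (\<forall>x\<in>J'. \<forall>y\<in>J'. f (x + y) = add (f x) (f y))
    \<and> (\<forall>r. \<forall>x\<in>J'. f (emb r * x) = sm r (f x))
    \<and> f ` J' = M
    \<and> (\<forall>x\<in>J'. f x = z \<longleftrightarrow> x \<in> A))"

definition Ann :: "'m set \<Rightarrow> 'm \<Rightarrow> ('r::idom \<Rightarrow> 'm \<Rightarrow> 'm) \<Rightarrow> 'm \<Rightarrow> 'r set" where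
  "Ann M z sm a = {r. sm r a = z}"

definition Dset :: "'m set \<Rightarrow> ('r::idom \<Rightarrow> 'm \<Rightarrow> 'm) \<Rightarrow> 'm \<Rightarrow> 'r fract set" where
  "Dset M sm a = \<Union> {invR r | r. r \<noteq> 0 \<and> (\<exists>u\<in>M. a = sm r u)}"

text \<open>U has type J/A: J/A is isomorphic to D(a)/Ann(a) (for every nonzero a; this
  is independent of a).\<close>
definition has_type :: "'m set \<Rightarrow> ('m \<Rightarrow> 'm \<Rightarrow> 'm) \<Rightarrow> 'm \<Rightarrow> ('r::idom \<Rightarrow> 'm \<Rightarrow> 'm)
     \<Rightarrow> 'r fract set \<Rightarrow> 'r fract set \<Rightarrow> bool" where
  "has_type M add z sm J A \<longleftrightarrow>
     (\<forall>a\<in>M. a \<noteq> z \<longrightarrow> quot_iso J A (Dset M sm a) (emb ` Ann M z sm a))"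

definition omega1_like :: "'i::wellorder itself \<Rightarrow> bool" where
  "omega1_like _ \<longleftrightarrow> uncountable (UNIV :: 'i set) \<and> (\<forall>x::'i. countable {y. y < x})"

definition is_limit :: "'i::wellorder \<Rightarrow> bool" where
  "is_limit d \<longleftrightarrow> (\<exists>b. b < d) \<and> (\<forall>b<d. \<exists>c. b < c \<and> c < d)"

definition cub :: "'i::wellorder set \<Rightarrow> bool" where
  "cub C \<longleftrightarrow> (\<forall>a. \<exists>c\<in>C. a < c)
     \<and> (\<forall>d. is_limit d \<and> (\<forall>b<d. \<exists>c\<in>C. b < c \<and> c < d) \<longrightarrow> d \<in> C)"

definition stationary :: "'i::wellorder set \<Rightarrow> bool" where
  "stationary S \<longleftrightarrow> (\<forall>C. cub C \<longrightarrow> S \<inter> C \<noteq> {})"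

text \<open>R / (\<Inter>_{s<d} r_s R) with the linear topology given by the images of r_s R (s < d)
  is complete: it is metrizable (d countable), so completeness means every Cauchy
  sequence converges. Since \<Inter>_{s<d} r_s R \<subseteq> r_t R, working with representatives in R,
  x_m - x_n lies in the image of r_s R iff r_s divides x_m - x_n.\<close>
definition quot_complete :: "('i::wellorder \<Rightarrow> 'r::idom) \<Rightarrow> 'i \<Rightarrow> bool" where
  "quot_complete r d \<longleftrightarrow> (\<forall>x :: nat \<Rightarrow> 'r.
     (\<forall>s<d. \<exists>N. \<forall>m\<ge>N. \<forall>n\<ge>N. r s dvd (x m - x n))
     \<longrightarrow> (\<exists>y. \<forall>s<d. \<exists>N. \<forall>n\<ge>N. r s dvd (x n - y)))"

definition Gamma_set :: "('i::wellorder \<Rightarrow> 'r::idom) \<Rightarrow> 'i set" where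
  "Gamma_set r = {d. is_limit d \<and> \<not> quot_complete r d}"

definition represents :: "('i::wellorder \<Rightarrow> 'r::idom) \<Rightarrow> 'r fract set \<Rightarrow> bool" where
  "represents r J \<longleftrightarrow> (\<forall>s. r s \<noteq> 0) \<and> (\<forall>t s. t < s \<longrightarrow> r t dvd r s)
     \<and> J = (\<Union>s. invR (r s))"

end

theory Submission
  imports Defs "HOL-Analysis.Abstract_Topology_2"
begin

text \<open>
  A uniserial module of type \<open>J/R\<close> is a direct limit of the modules \<open>R/r\<^sub>s R\<close> along multiplication
  by \<open>(r\<^sub>t/r\<^sub>s) E\<^sub>t\<^sub>s\<close>, where the \<open>E\<^sub>t\<^sub>s\<close> are units that are coherent modulo \<open>r\<^sub>s\<close>. It is standard only
  if the family is trivial, that is, if it has a thread: units \<open>v\<^sub>s\<close> with \<open>v\<^sub>s \<equiv> E\<^sub>t\<^sub>s v\<^sub>t\<close> modulo \<open>r\<^sub>s\<close>.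
  The family \<open>E\<close> is built one column \<open>(E\<^sub>d\<^sub>s)\<^sub>s\<^sub><\<^sub>d\<close> at a time. Of \<open>\<Gamma>(J/R) \<noteq> 0\<close> only the consequence
  is needed that the ideals \<open>r\<^sub>s R\<close> do not stabilise.

  If, after thinning out, all quotients \<open>r\<^sub>s R/r\<^sub>t R\<close> are uncountable, exhaust \<open>R\<close> by countable sets
  \<open>N\<^sub>d\<close>. At a limit \<open>d\<close> there are continuum many columns that lie pairwise in different classes modulo
  the threads with values in \<open>N\<^sub>d\<close>; as \<open>R\<close> has fewer elements than the continuum, one of them is not
  completed by any \<open>h \<in> R\<close> to a thread with values in \<open>N\<^sub>d\<close>. A thread of the whole family takes
  values in \<open>N\<^sub>d\<close> below some limit \<open>d\<close>, which is a contradiction.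

  Otherwise \<open>r\<^sub>n R/r\<^sub>t R\<close> is countable for a fixed \<open>n\<close> and all \<open>t > n\<close>. Choosing all units congruent
  to 1 modulo \<open>r\<^sub>n\<close>, the approximations of threads form a tree of height \<open>\<omega>\<^sub>1\<close> with countable levels,
  and the columns are chosen together with a strictly increasing map from the tree to the rationals,
  as for a special Aronszajn tree. A thread would then yield an injection of \<open>\<omega>\<^sub>1\<close> into the rationals.
\<close>

section \<open>Congruences, fractions and the direct limit\<close>

definition eqm :: "'r::idom \<Rightarrow> 'r \<Rightarrow> 'r \<Rightarrow> bool" where
  "eqm d x y \<longleftrightarrow> d dvd x - y"

lemma eqm_refl [simp]: "eqm d x x"
  by (simp add: eqm_def)

lemma eqm_sym: "eqm d x y \<Longrightarrow> eqm d y x"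
  unfolding eqm_def by (metis dvd_minus_iff minus_diff_eq)

lemma eqm_trans [trans]: "eqm d x y \<Longrightarrow> eqm d y z \<Longrightarrow> eqm d x z"
  unfolding eqm_def using dvd_add[of d "x - y" "y - z"] by simp

lemma eqm_cong_iff: "eqm d x x' \<Longrightarrow> eqm d y y' \<Longrightarrow> eqm d x y \<longleftrightarrow> eqm d x' y'"
  using eqm_sym eqm_trans by blast

lemma eqm_add: "eqm d x y \<Longrightarrow> eqm d u v \<Longrightarrow> eqm d (x + u) (y + v)"
  unfolding eqm_def using dvd_add[of d "x - y" "u - v"] by (simp add: algebra_simps)

lemma eqm_mult: assumes "eqm d x y" "eqm d u v" shows "eqm d (x * u) (y * v)"
proof -
  have "x * u - y * v = (x - y) * u + y * (u - v)" by (simp add: algebra_simps)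
  then show ?thesis using assms unfolding eqm_def by simp
qed

lemma eqm_dvd: "a dvd b \<Longrightarrow> eqm b x y \<Longrightarrow> eqm a x y"
  unfolding eqm_def by (rule dvd_trans)

lemma unit_inverse: assumes "(u::'r::idom) dvd 1" obtains w where "u * w = 1" "w dvd 1"
  using assms unfolding dvd_def by (metis mult.commute)

lemma unit_mult: "(u::'r::idom) dvd 1 \<Longrightarrow> v dvd 1 \<Longrightarrow> u * v dvd 1"
  using mult_dvd_mono[of u 1 v 1] by simp

lemma dvd_unit_mult_iff: assumes "(u::'r::idom) dvd 1" shows "d dvd u * a \<longleftrightarrow> d dvd a"
proof
  assume "d dvd u * a"
  obtain w where "u * w = 1" using assms unit_inverse by blast
  then have "a = w * (u * a)" by (metis mult.assoc mult.commute mult_1_left)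
  with \<open>d dvd u * a\<close> show "d dvd a" by (metis dvd_mult)
qed simp

lemma eqm_unit_cancel: "u dvd 1 \<Longrightarrow> eqm d (u * x) (u * y) \<longleftrightarrow> eqm d x y"
  unfolding eqm_def by (metis dvd_unit_mult_iff right_diff_distrib)

section \<open>The embedding into the quotient field\<close>

lemma emb_mult: "emb (a * b) = emb a * emb b"
  by (simp add: emb_def)

lemma emb_minus: "emb (- a) = - emb a"
  by (simp add: emb_def)

lemma emb_diff: "emb (a - b) = emb a - emb b"
  by (simp add: emb_def)

lemma emb_0 [simp]: "emb 0 = 0"
  by (simp add: emb_def Zero_fract_def)

lemma emb_1 [simp]: "emb 1 = 1"
  by (simp add: emb_def One_fract_def)

lemma emb_eq_iff [simp]: "emb a = emb b \<longleftrightarrow> a = b"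
  by (simp add: emb_def eq_fract)

lemma emb_eq_0_iff [simp]: "emb a = 0 \<longleftrightarrow> a = 0"
  using emb_eq_iff[of a 0] by simp

lemma Fract_eq_emb: "b \<noteq> 0 \<Longrightarrow> Fraction_Field.Fract a b = emb a / emb b"
  by (simp add: emb_def)

lemma fract_cases: obtains a b where "x = emb a / emb b" "b \<noteq> 0"
  by (cases x) (metis Fract_eq_emb)

lemma mem_invR_iff: "q \<noteq> 0 \<Longrightarrow> x \<in> invR q \<longleftrightarrow> (\<exists>s. emb q * x = emb s)"
  unfolding invR_def by (auto simp: Fract_eq_emb field_simps)

lemma invR_mono: assumes "a dvd b" "b \<noteq> 0" shows "invR a \<subseteq> invR b"
proof
  fix x assume x: "x \<in> invR a"
  from assms obtain c where c: "b = a * c" unfolding dvd_def by blast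
  with assms have "a \<noteq> 0" by auto
  with x obtain s where "emb a * x = emb s" by (auto simp: mem_invR_iff)
  then have "emb b * x = emb (c * s)" by (simp add: c emb_mult mult_ac)
  then show "x \<in> invR b" using assms by (auto simp: mem_invR_iff)
qed

lemma valuation_dvd_total:
  assumes "valuation_domain TYPE('r::idom)" shows "(a::'r) dvd b \<or> b dvd a"
proof -
  have id: "is_ideal {x. c dvd x}" for c :: 'r
    by (auto simp: is_ideal_def)
  have "{x. a dvd x} \<subseteq> {x. b dvd x} \<or> {x. b dvd x} \<subseteq> {x. a dvd x}"
    using assms id unfolding valuation_domain_def by blast
  then show ?thesis by (metis dvd_refl mem_Collect_eq subsetD)
qed

section \<open>Descending chains of principal ideals in a valuation domain\<close>

locale val_chain =
  fixes r :: "'i::wellorder \<Rightarrow> 'r::idom"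
  assumes dvd_total: "a dvd b \<or> b dvd (a::'r)"
    and r_nz: "r s \<noteq> 0"
    and r_dvd: "s \<le> t \<Longrightarrow> r s dvd r t"
    and r_nonunit: "\<not> r s dvd 1"
begin

text \<open>If \<open>1 + x\<close> divides \<open>r s\<close>, it divides \<open>x\<close> and
  therefore 1; if \<open>r s\<close> divides \<open>1 + x\<close>, it divides 1, contrary to
  \<open>r_nonunit\<close>. So units can be recognised modulo any \<open>r s\<close>.\<close>

lemma one_plus_unit: assumes "r s dvd x" shows "(1 + x) dvd 1"
  by (metis add_diff_cancel_right' assms dvd_add_left_iff dvd_refl dvd_total dvd_trans r_nonunit)

lemma unit_eqm: assumes "eqm (r s) x y" "x dvd 1" shows "y dvd 1"
proof -
  obtain w where w: "x * w = 1" "w dvd 1" using assms unit_inverse by blast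
  have "r s dvd w * (y - x)" using eqm_sym[OF assms(1)] unfolding eqm_def by simp
  then have "(1 + w * (y - x)) dvd 1" by (rule one_plus_unit)
  moreover have "1 + w * (y - x) = w * y" using w by (simp add: algebra_simps)
  ultimately show ?thesis by (metis dvd_mult_right)
qed

end

text \<open>The first index of \<open>E\<close> is the upper level. The cocycle identity is asked
  only modulo \<open>r s\<close>: multiplied by \<open>q s p\<close>, its error becomes a multiple
  of \<open>r p\<close>, and this makes the transition maps compose in the quotients.\<close>

locale coherent_chain = val_chain r for r :: "'i::wellorder \<Rightarrow> 'r::idom" +
  fixes E :: "'i \<Rightarrow> 'i \<Rightarrow> 'r"
  assumes E_unit: "s \<le> t \<Longrightarrow> E t s dvd 1"
    and E_refl: "E s s = 1"
    and E_coh: "s \<le> t \<Longrightarrow> t \<le> p \<Longrightarrow> eqm (r s) (E p s) (E t s * E p t)"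
begin

definition q :: "'i \<Rightarrow> 'i \<Rightarrow> 'r" where
  "q s t = (SOME k. r t = r s * k)"

lemma q: "s \<le> t \<Longrightarrow> r t = r s * q s t"
  unfolding q_def by (rule someI_ex) (metis dvdE r_dvd)

lemma q_nz: "s \<le> t \<Longrightarrow> q s t \<noteq> 0"
  using q r_nz by (metis mult_zero_right)

lemma q_refl: "q s s = 1"
  using q[of s s] r_nz[of s] by simp

lemma q_trans: assumes "s \<le> t" "t \<le> p" shows "q s p = q t p * q s t"
proof -
  have "r s * q s p = r s * (q t p * q s t)"
    using q[of s t] q[of t p] q[OF order_trans[OF assms]] assms by (simp add: mult_ac)
  then show ?thesis using r_nz by simp
qed

text \<open>The transition map from \<open>R/r\<^sub>s R\<close> to \<open>R/r\<^sub>t R\<close> is multiplication by \<open>tr s t\<close>.\<close>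

definition tr :: "'i \<Rightarrow> 'i \<Rightarrow> 'r" where
  "tr s t = q s t * E t s"

lemma tr_refl: "tr s s = 1"
  by (simp add: tr_def q_refl E_refl)

text \<open>Cancelling \<open>q s t\<close> and the unit \<open>E t s\<close> shows that the
  transition maps are well defined and injective.\<close>

lemma tr_dvd_iff: assumes "s \<le> t" shows "r t dvd tr s t * a \<longleftrightarrow> r s dvd a"
proof -
  have "r t dvd tr s t * a \<longleftrightarrow> q s t * r s dvd q s t * (E t s * a)"
    using q[OF assms] by (simp add: tr_def mult_ac)
  also have "\<dots> \<longleftrightarrow> r s dvd E t s * a" using q_nz[OF assms] by simp
  also have "\<dots> \<longleftrightarrow> r s dvd a" by (rule dvd_unit_mult_iff[OF E_unit[OF assms]])
  finally show ?thesis .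
qed

lemma tr_eqm_iff: "s \<le> t \<Longrightarrow> eqm (r t) (tr s t * a) (tr s t * b) \<longleftrightarrow> eqm (r s) a b"
  unfolding eqm_def by (metis tr_dvd_iff right_diff_distrib)

lemma tr_trans: assumes "s \<le> t" "t \<le> p" shows "eqm (r p) (tr t p * tr s t) (tr s p)"
proof -
  have "tr s p - tr t p * tr s t = q s p * (E p s - E t s * E p t)"
    by (simp add: tr_def q_trans[OF assms] algebra_simps)
  moreover have "q s p * r s dvd q s p * (E p s - E t s * E p t)"
    using E_coh[OF assms] by (simp add: eqm_def)
  ultimately have "r p dvd tr s p - tr t p * tr s t"
    using q[of s p] assms by (metis mult.commute order_trans)
  then show ?thesis by (metis eqm_def eqm_sym)
qed

text \<open>Equality in the direct limit of elements given at different levels. As the transition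
  maps are injective, any common upper level decides it (\<open>rel_iff\<close>).\<close>

definition rel :: "'i \<times> 'r \<Rightarrow> 'i \<times> 'r \<Rightarrow> bool" where
  "rel x y \<longleftrightarrow> (\<exists>p \<ge> max (fst x) (fst y). eqm (r p) (tr (fst x) p * snd x) (tr (fst y) p * snd y))"

lemma tr_push: assumes "s \<le> p" "p \<le> p'"
  shows "eqm (r p') (tr p p' * (tr s p * a)) (tr s p' * a)"
  using eqm_mult[OF tr_trans[OF assms] eqm_refl] by (simp add: mult.assoc)

lemma eqm_level_iff: assumes "s \<le> p" "t \<le> p" "p \<le> p'"
  shows "eqm (r p') (tr s p' * a) (tr t p' * b) \<longleftrightarrow> eqm (r p) (tr s p * a) (tr t p * b)"
proof -
  note 1 = tr_push[OF assms(1,3)] tr_push[OF assms(2,3)]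
  have "eqm (r p') (tr s p' * a) (tr t p' * b) \<longleftrightarrow>
        eqm (r p') (tr p p' * (tr s p * a)) (tr p p' * (tr t p * b))"
    by (rule eqm_cong_iff[OF eqm_sym[OF 1(1)] eqm_sym[OF 1(2)]])
  then show ?thesis using tr_eqm_iff[OF assms(3)] by blast
qed

lemma rel_iff: assumes "s \<le> p" "t \<le> p"
  shows "rel (s, a) (t, b) \<longleftrightarrow> eqm (r p) (tr s p * a) (tr t p * b)"
proof
  assume "rel (s, a) (t, b)"
  then obtain p' where p': "s \<le> p'" "t \<le> p'" "eqm (r p') (tr s p' * a) (tr t p' * b)"
    by (auto simp: rel_def)
  then have "eqm (r (max p p')) (tr s (max p p') * a) (tr t (max p p') * b)"
    using eqm_level_iff[of s p' t "max p p'"] by simp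
  then show "eqm (r p) (tr s p * a) (tr t p * b)"
    using eqm_level_iff[of s p t "max p p'"] assms by simp
qed (use assms in \<open>auto simp: rel_def\<close>)

lemma equivp_rel: "equivp rel"
proof (rule equivpI)
  show "reflp rel" by (rule reflpI) (auto simp: rel_def)
  show "symp rel" by (rule sympI) (auto simp: rel_def intro: eqm_sym)
  show "transp rel"
  proof (rule transpI)
    fix x y z assume xy: "rel x y" and yz: "rel y z"
    obtain s a t b u c where eq: "x = (s, a)" "y = (t, b)" "z = (u, c)" by (metis surj_pair)
    define p where "p = max s (max t u)"
    have p: "s \<le> p" "t \<le> p" "u \<le> p" by (simp_all add: p_def le_max_iff_disj)
    show "rel x z" using xy yz
      unfolding eq rel_iff[OF p(1,2)] rel_iff[OF p(2,3)] rel_iff[OF p(1,3)] by (rule eqm_trans)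
  qed
qed

end

text \<open>The direct limit, presented by its canonical maps \<open>\<iota> s : R \<rightarrow> U\<close>, whose kernels are \<open>r\<^sub>s R\<close>.\<close>

locale direct_limit = coherent_chain r E for r :: "'i::wellorder \<Rightarrow> 'r::idom" and E +
  fixes \<iota> :: "'i \<Rightarrow> 'r \<Rightarrow> 'm"
  assumes \<iota>_eq_iff: "\<iota> s a = \<iota> s b \<longleftrightarrow> eqm (r s) a b"
    and \<iota>_tr: "s \<le> t \<Longrightarrow> \<iota> s a = \<iota> t (tr s t * a)"
begin

definition carr :: "'m set" where
  "carr = {\<iota> s a | s a. True}"

text \<open>The operations are picked from arbitrary representatives, for sums at a common level;
  the lemmas \<open>uadd\<close> and \<open>usm\<close> show that the choice is irrelevant.\<close>

definition uadd :: "'m \<Rightarrow> 'm \<Rightarrow> 'm" where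
  "uadd x y = (SOME w. \<exists>s a b. x = \<iota> s a \<and> y = \<iota> s b \<and> w = \<iota> s (a + b))"

definition usm :: "'r \<Rightarrow> 'm \<Rightarrow> 'm" where
  "usm c x = (SOME w. \<exists>s a. x = \<iota> s a \<and> w = \<iota> s (c * a))"

definition uzero :: 'm where
  "uzero = \<iota> (LEAST s. True) 0"

lemma \<iota>_eq_level: assumes "s \<le> p" "t \<le> p"
  shows "\<iota> s a = \<iota> t b \<longleftrightarrow> eqm (r p) (tr s p * a) (tr t p * b)"
proof -
  have "\<iota> s a = \<iota> p (tr s p * a)" by (rule \<iota>_tr[OF assms(1)])
  moreover have "\<iota> t b = \<iota> p (tr t p * b)" by (rule \<iota>_tr[OF assms(2)])
  ultimately show ?thesis by (metis \<iota>_eq_iff)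
qed

lemma uadd: "uadd (\<iota> s a) (\<iota> s b) = \<iota> s (a + b)"
proof -
  have "w = \<iota> s (a + b)" if w: "\<iota> s a = \<iota> t a'" "\<iota> s b = \<iota> t b'" "w = \<iota> t (a' + b')" for w t a' b'
  proof -
    define p where "p = max s t"
    have p: "s \<le> p" "t \<le> p" by (auto simp: p_def)
    have "eqm (r p) (tr s p * a + tr s p * b) (tr t p * a' + tr t p * b')"
      using w(1,2) unfolding \<iota>_eq_level[OF p] by (rule eqm_add)
    then show ?thesis unfolding w(3) \<iota>_eq_level[OF p(2,1)] distrib_left by (rule eqm_sym)
  qed
  then show ?thesis unfolding uadd_def by (intro some_equality) (blast, elim exE conjE, simp only:)
qed

lemma usm: "usm c (\<iota> s a) = \<iota> s (c * a)"
proof -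
  have "w = \<iota> s (c * a)" if w: "\<iota> s a = \<iota> t a'" "w = \<iota> t (c * a')" for w t a'
  proof -
    define p where "p = max s t"
    have p: "s \<le> p" "t \<le> p" by (auto simp: p_def)
    have "eqm (r p) (c * (tr s p * a)) (c * (tr t p * a'))"
      using w(1) unfolding \<iota>_eq_level[OF p] by (rule eqm_mult[OF eqm_refl])
    then show ?thesis unfolding w(2) \<iota>_eq_level[OF p(2,1)] mult.left_commute[of _ c] by (rule eqm_sym)
  qed
  then show ?thesis unfolding usm_def by (intro some_equality) (blast, elim exE conjE, simp only:)
qed

lemma uzero: "\<iota> s 0 = uzero"
  unfolding uzero_def using \<iota>_tr[of "LEAST s. True" s 0] by (simp add: Least_le)

lemma carr_level: assumes "x \<in> carr" obtains s where "\<And>t. s \<le> t \<Longrightarrow> \<exists>a. x = \<iota> t a"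
  using assms \<iota>_tr unfolding carr_def by blast

lemma common_level2: assumes "x \<in> carr" "y \<in> carr"
  obtains s a b where "p \<le> s" "x = \<iota> s a" "y = \<iota> s b"
proof -
  obtain s where s: "\<And>t. s \<le> t \<Longrightarrow> \<exists>a. x = \<iota> t a" using carr_level[OF assms(1)] by blast
  obtain s' where s': "\<And>t. s' \<le> t \<Longrightarrow> \<exists>a. y = \<iota> t a" using carr_level[OF assms(2)] by blast
  show ?thesis using that[of "max p (max s s')"] s[of "max p (max s s')"] s'[of "max p (max s s')"]
    by (auto simp: max.coboundedI1 max.coboundedI2)
qed

lemma common_level3: assumes "x \<in> carr" "y \<in> carr" "w \<in> carr"
  obtains s a b c where "x = \<iota> s a" "y = \<iota> s b" "w = \<iota> s c"
proof -
  obtain p where p: "\<And>t. p \<le> t \<Longrightarrow> \<exists>a. w = \<iota> t a" using carr_level[OF assms(3)] by blast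
  obtain s a b where "p \<le> s" "x = \<iota> s a" "y = \<iota> s b" using common_level2[OF assms(1,2)] by blast
  then show ?thesis using p that by blast
qed

lemma \<iota>_carr [simp]: "\<iota> s a \<in> carr"
  by (auto simp: carr_def)

lemma module_carr: "is_module carr uadd uzero usm"
  unfolding is_module_def
proof (intro conjI ballI allI)
  show "uzero \<in> carr" by (simp add: uzero_def)
  fix x assume x: "x \<in> carr"
  obtain s a where a: "x = \<iota> s a" using x by (auto simp: carr_def)
  show "uadd uzero x = x" using a uadd[of s 0 a] by (simp add: uzero)
  show "usm 1 x = x" using a by (simp add: usm)
  show "\<exists>y\<in>carr. uadd x y = uzero" using a uadd[of s a "- a"] uzero[of s] by (metis \<iota>_carr add.right_inverse)
  fix c d :: 'r
  show "usm c x \<in> carr" using a by (simp add: usm)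
  show "usm (c + d) x = uadd (usm c x) (usm d x)" using a by (simp add: usm uadd distrib_right)
  show "usm (c * d) x = usm c (usm d x)" using a by (simp add: usm mult.assoc)
next
  fix x y assume "x \<in> carr" "y \<in> carr"
  then obtain s a b where ab: "x = \<iota> s a" "y = \<iota> s b" using common_level2 by metis
  show "uadd x y \<in> carr" using ab by (simp add: uadd)
  show "uadd x y = uadd y x" using ab by (simp add: uadd add.commute)
  fix c
  show "usm c (uadd x y) = uadd (usm c x) (usm c y)" using ab by (simp add: uadd usm distrib_left)
next
  fix x y w assume "x \<in> carr" "y \<in> carr" "w \<in> carr"
  then obtain s a b c where "x = \<iota> s a" "y = \<iota> s b" "w = \<iota> s c" using common_level3 by metis
  then show "uadd (uadd x y) w = uadd x (uadd y w)" by (simp add: uadd add.assoc)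
qed

lemma uniserial_carr: "uniserial carr uadd uzero usm"
proof -
  have "N1 \<subseteq> N2 \<or> N2 \<subseteq> N1"
    if N: "submodule N1 carr uadd uzero usm" "submodule N2 carr uadd uzero usm" for N1 N2
  proof (rule ccontr)
    assume "\<not> ?thesis"
    then obtain x y where xy: "x \<in> N1" "x \<notin> N2" "y \<in> N2" "y \<notin> N1" by blast
    then have "x \<in> carr" "y \<in> carr" using N by (auto simp: submodule_def)
    then obtain s a b where ab: "x = \<iota> s a" "y = \<iota> s b" using common_level2 by metis
    from dvd_total[of a b] show False
    proof
      assume "a dvd b" then obtain c where "b = c * a" by (metis dvdE mult.commute)
      then have "y = usm c x" using ab by (simp add: usm)
      then show False using N(1) xy by (auto simp: submodule_def)
    next
      assume "b dvd a" then obtain c where "a = c * b" by (metis dvdE mult.commute)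
      then have "x = usm c y" using ab by (simp add: usm)
      then show False using N(2) xy by (auto simp: submodule_def)
    qed
  qed
  then show ?thesis using module_carr by (auto simp: uniserial_def)
qed

lemma \<iota>_eq_uzero_iff: "\<iota> s a = uzero \<longleftrightarrow> r s dvd a"
  using \<iota>_eq_iff[of s a 0] by (simp add: uzero eqm_def)

text \<open>For nonzero \<open>x = \<iota> s a\<close> write \<open>r s = a * k\<close>. The
  annihilator of \<open>x\<close> is \<open>k R\<close> and \<open>D(x)\<close> is
  \<open>k J\<close>, so multiplication by \<open>k\<close> induces the isomorphism.\<close>

lemma has_type_carr: assumes rep: "represents r J" shows "has_type carr uadd uzero usm J Rset"
  unfolding has_type_def
proof (intro ballI impI)
  fix x assume x: "x \<in> carr" "x \<noteq> uzero"
  then obtain s a where xa: "x = \<iota> s a" by (auto simp: carr_def)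
  then have nd: "\<not> r s dvd a" using x \<iota>_eq_uzero_iff by simp
  then obtain k where k: "r s = a * k" using dvd_total[of "r s" a] unfolding dvd_def by blast
  have a0: "a \<noteq> 0" "k \<noteq> 0" using k r_nz[of s] by auto
  have Ann: "Ann carr uzero usm x = {c. k dvd c}"
    using xa a0 by (auto simp: Ann_def usm \<iota>_eq_uzero_iff k mult.commute)
  have J: "J = (\<Union>s. invR (r s))" using rep by (simp add: represents_def)
  \<comment> \<open>Divisibility of \<open>x\<close> by \<open>c\<close> is tested at one level
    \<open>t\<close>; the condition \<open>c * k dvd r t\<close> translates \<open>D(x)\<close> into
    the union of the \<open>invR (r t)\<close>.\<close>
  have div_iff: "(\<exists>u\<in>carr. x = usm c u) \<longleftrightarrow> (\<exists>t\<ge>s. c * k dvd r t)" if c: "c \<noteq> 0" for c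
  proof
    assume "\<exists>u\<in>carr. x = usm c u"
    then obtain u where u: "u \<in> carr" "x = usm c u" by blast
    then obtain t b where t: "s \<le> t" "u = \<iota> t b"
      using common_level2[OF u(1) u(1), of s] by blast
    have "\<iota> t (tr s t * a) = \<iota> t (c * b)"
      using \<iota>_tr[OF t(1), of a] u t xa by (simp add: usm)
    then have eq: "eqm (r t) (tr s t * a) (c * b)" by (simp add: \<iota>_eq_iff)
    have "\<not> r t dvd c"
    proof
      assume "r t dvd c"
      then have "r t dvd tr s t * a" using eq unfolding eqm_def
        by (metis dvd_add diff_add_cancel dvd_mult2)
      then show False using tr_dvd_iff t(1) nd by blast
    qed
    then have "c dvd r t" using dvd_total by blast
    then have "c dvd tr s t * a" using eq unfolding eqm_def
      by (metis dvd_add diff_add_cancel dvd_trans dvd_triv_left)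
    then have "c dvd q s t * a" using dvd_unit_mult_iff[OF E_unit[OF t(1)], of c "q s t * a"]
      by (simp add: tr_def mult_ac)
    then have "c * k dvd q s t * a * k" by simp
    then have "c * k dvd r t" using q[OF t(1)] k by (simp add: mult_ac)
    then show "\<exists>t\<ge>s. c * k dvd r t" using t(1) by blast
  next
    assume "\<exists>t\<ge>s. c * k dvd r t"
    then obtain t d where t: "s \<le> t" "r t = c * k * d" unfolding dvd_def by blast
    then have "k * (q s t * a) = k * (c * d)" using q[OF t(1)] k by (simp add: mult_ac)
    then have "q s t * a = c * d" using a0 by simp
    then have "tr s t * a = c * (d * E t s)" by (simp add: tr_def mult_ac)
    then have "x = usm c (\<iota> t (d * E t s))" using xa \<iota>_tr[OF t(1), of a] by (simp add: usm)
    then show "\<exists>u\<in>carr. x = usm c u" by auto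
  qed
  have D: "Dset carr usm x = (\<lambda>y. emb k * y) ` J"
  proof (intro equalityI subsetI)
    fix y assume "y \<in> Dset carr usm x"
    then obtain c where c: "c \<noteq> 0" "\<exists>u\<in>carr. x = usm c u" "y \<in> invR c" by (auto simp: Dset_def)
    then obtain t d where td: "r t = c * k * d" using div_iff unfolding dvd_def by blast
    obtain e where e: "emb c * y = emb e" using c by (auto simp: mem_invR_iff)
    have "emb (r t) * (y / emb k) = emb d * (emb c * y)" using a0 by (simp add: td emb_mult mult_ac)
    also have "\<dots> = emb (d * e)" by (simp add: e emb_mult)
    finally have "y / emb k \<in> invR (r t)" using r_nz by (auto simp: mem_invR_iff)
    moreover have "y = emb k * (y / emb k)" using a0 by simp
    ultimately show "y \<in> (\<lambda>y. emb k * y) ` J" unfolding J by blast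
  next
    fix y assume "y \<in> (\<lambda>y. emb k * y) ` J"
    then obtain w t' where w: "y = emb k * w" "w \<in> invR (r t')" by (auto simp: J)
    define t where "t = max s t'"
    have t: "s \<le> t" "t' \<le> t" by (auto simp: t_def)
    have wt: "w \<in> invR (r t)" using w invR_mono[OF r_dvd[OF t(2)]] r_nz by blast
    then obtain e where e: "emb (r t) * w = emb e" using r_nz by (auto simp: mem_invR_iff)
    define c where "c = q s t * a"
    have rt: "r t = c * k" using q[OF t(1)] k by (simp add: c_def mult_ac)
    have c0: "c \<noteq> 0" using rt r_nz[of t] by auto
    have "emb c * y = emb e" using e by (simp add: rt w emb_mult mult_ac)
    then have "y \<in> invR c" using c0 by (auto simp: mem_invR_iff)
    moreover have "\<exists>u\<in>carr. x = usm c u" using div_iff[OF c0] rt t by auto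
    ultimately show "y \<in> Dset carr usm x" using c0 unfolding Dset_def by blast
  qed
  show "quot_iso J Rset (Dset carr usm x) (emb ` Ann carr uzero usm x)"
    unfolding quot_iso_def
  proof (intro exI[of _ "\<lambda>y. emb k * y"] conjI ballI allI)
    have z: "0 \<in> emb ` Ann carr uzero usm x" unfolding Ann by (rule image_eqI[of _ _ 0]) auto
    show "\<And>y. y \<in> J \<Longrightarrow> emb k * y \<in> Dset carr usm x" by (auto simp: D)
    show "\<And>y w. emb k * (y + w) - (emb k * y + emb k * w) \<in> emb ` Ann carr uzero usm x"
      using z by (simp add: distrib_left)
    show "\<And>c y. emb k * (emb c * y) - emb c * (emb k * y) \<in> emb ` Ann carr uzero usm x"
      using z by (simp add: mult.left_commute)
    show "(emb k * y \<in> emb ` Ann carr uzero usm x) = (y \<in> Rset)" for y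
    proof
      assume "emb k * y \<in> emb ` Ann carr uzero usm x"
      then obtain c where "emb k * y = emb (k * c)" unfolding Ann dvd_def by blast
      then show "y \<in> Rset" using a0 by (simp add: emb_mult Rset_def)
    next
      assume "y \<in> Rset"
      then show "emb k * y \<in> emb ` Ann carr uzero usm x"
        by (auto simp: Ann Rset_def emb_mult[symmetric])
    qed
    show "\<And>x'. x' \<in> Dset carr usm x \<Longrightarrow> \<exists>xa\<in>J. emb k * xa - x' \<in> emb ` Ann carr uzero usm x"
    proof -
      fix x' assume "x' \<in> Dset carr usm x"
      then obtain y where "y \<in> J" "x' = emb k * y" by (auto simp: D)
      then show "\<exists>y\<in>J. emb k * y - x' \<in> emb ` Ann carr uzero usm x" using z by (intro bexI[of _ y]) simp_all
    qed
  qed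
qed

text \<open>Lift the generators \<open>\<iota> s 1\<close> to elements \<open>x s\<close> of the
  quotient field. Each \<open>r s * x s\<close> differs from \<open>r o0 * x o0\<close> by a unit
  factor \<open>v s\<close>, and these factors form the thread.\<close>

lemma thread_if_standard:
  assumes "standard carr uadd uzero usm"
  obtains v where "\<And>s. v s dvd 1" "\<And>s t. s \<le> t \<Longrightarrow> eqm (r s) (v s) (E t s * v t)"
proof -
  obtain J' A and f :: "'r fract \<Rightarrow> 'm" where J': "Q_submodule J'"
    and f_add': "\<forall>x\<in>J'. \<forall>y\<in>J'. f (x + y) = uadd (f x) (f y)"
    and f_sm': "\<forall>c. \<forall>x\<in>J'. f (emb c * x) = usm c (f x)"
    and f_onto: "f ` J' = carr"
    using assms unfolding standard_def by (elim exE conjE) (rule that)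
  note f_add = bspec[OF bspec[OF f_add']] and f_sm = bspec[OF spec[OF f_sm']]
  define o0 :: 'i where "o0 = (LEAST s. True)"
  have o0: "o0 \<le> s" for s by (simp add: o0_def Least_le)
  have "\<forall>s. \<exists>x\<in>J'. f x = \<iota> s 1" using f_onto \<iota>_carr by (metis imageE)
  then obtain x where x: "\<And>s. x s \<in> J'" "\<And>s. f (x s) = \<iota> s 1" by metis
  \<comment> \<open>In the quotient field \<open>y\<close> and \<open>x o0\<close> are comparable:
    either \<open>y\<close> is a multiple of \<open>x o0\<close> whose coefficient kills
    \<open>\<iota> o0 1\<close>, or \<open>x o0\<close> is a multiple of \<open>y\<close> and would
    be sent to zero.\<close>
  have ker: "\<exists>c. y = emb (r o0 * c) * x o0" if y: "y \<in> J'" "f y = uzero" for y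
  proof -
    have fx: "f (x o0) \<noteq> uzero" using x r_nonunit by (simp add: \<iota>_eq_uzero_iff)
    have f0: "f 0 = uzero" using f_sm[OF y(1), of 0] y usm[of 0 o0 0] by (simp add: uzero)
    have x0: "x o0 \<noteq> 0" using fx f0 by metis
    obtain a b where ab: "y / x o0 = emb a / emb b" "b \<noteq> 0" by (rule fract_cases)
    have y_eq: "emb b * y = emb a * x o0" using ab x0 by (simp add: field_simps)
    from dvd_total[of b a] show ?thesis
    proof
      assume "b dvd a" then obtain c where "a = b * c" unfolding dvd_def by blast
      then have yc: "y = emb c * x o0" using y_eq ab by (simp add: emb_mult)
      then have "\<iota> o0 c = uzero" using y f_sm[OF x(1), of c o0] x usm by simp
      then show ?thesis using yc unfolding \<iota>_eq_uzero_iff dvd_def by blast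
    next
      assume "a dvd b" then obtain c where c: "b = a * c" unfolding dvd_def by blast
      then have "x o0 = emb c * y" using y_eq ab by (simp add: emb_mult)
      then have "f (x o0) = usm c uzero" using f_sm y by simp
      also have "\<dots> = uzero" using usm[of c o0 0] by (simp add: uzero)
      finally show ?thesis using fx by simp
    qed
  qed
  have x0: "x o0 \<noteq> 0"
  proof
    assume "x o0 = 0"
    then have "f (emb 0 * x o0) = f (x o0)" by simp
    then have "\<iota> o0 0 = \<iota> o0 1" using f_sm[OF x(1)] x usm by (metis mult_zero_left)
    then show False using uzero \<iota>_eq_uzero_iff r_nonunit by metis
  qed
  have diff: "\<exists>c. x s - emb (tr s t) * x t = emb (r o0 * c) * x o0" if "s \<le> t" for s t
  proof (rule ker)
    have sm: "emb c * x t \<in> J'" for c using J' x by (simp add: Q_submodule_def)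
    have eq: "x s - emb (tr s t) * x t = x s + emb (- tr s t) * x t" by (simp add: emb_minus)
    show "x s - emb (tr s t) * x t \<in> J'"
      unfolding eq using J' x sm by (simp add: Q_submodule_def)
    have "f (x s + emb (- tr s t) * x t) = uadd (\<iota> s 1) (usm (- tr s t) (\<iota> t 1))"
      using f_add[OF x(1) sm] f_sm[OF x(1)] x by simp
    also have "\<dots> = uadd (\<iota> t (tr s t)) (\<iota> t (- tr s t))" using \<iota>_tr[OF that, of 1] by (simp add: usm)
    also have "\<dots> = uzero" by (simp add: uadd uzero)
    finally show "f (x s - emb (tr s t) * x t) = uzero" by (simp only: eq)
  qed
  \<comment> \<open>Up to the unit \<open>E s o0\<close>, the element \<open>q o0 s * x s\<close>
    equals \<open>x o0\<close> times \<open>1 - r o0 * c\<close>, which is a unit.\<close>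
  have "\<exists>v. v dvd 1 \<and> emb (r s) * x s = emb (r o0 * v) * x o0" for s
  proof -
    obtain c where c: "x o0 - emb (tr o0 s) * x s = emb (r o0 * c) * x o0"
      using diff[OF o0] by blast
    obtain w where w: "E s o0 * w = 1" "w dvd 1" using unit_inverse[OF E_unit[OF o0]] by blast
    have u: "(1 + r o0 * (- c)) dvd 1" by (rule one_plus_unit[of o0]) simp
    have "emb (q o0 s) * x s = emb (q o0 s * (E s o0 * w)) * x s" by (simp add: w)
    also have "\<dots> = emb w * (emb (tr o0 s) * x s)" by (simp add: tr_def emb_mult mult_ac)
    also have "emb (tr o0 s) * x s = x o0 - emb (r o0 * c) * x o0" using c by (simp add: algebra_simps)
    also have "\<dots> = emb (1 + r o0 * (- c)) * x o0" by (simp add: emb_diff algebra_simps)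
    finally have "emb (q o0 s) * x s = emb (w * (1 + r o0 * (- c))) * x o0" by (simp add: emb_mult mult_ac)
    then have "emb (r s) * x s = emb (r o0 * (w * (1 + r o0 * (- c)))) * x o0"
      unfolding q[OF o0[of s]] emb_mult by (simp add: mult.assoc)
    then show ?thesis using unit_mult[OF w(2) u] by blast
  qed
  then obtain v where v: "\<And>s. v s dvd 1" "\<And>s. emb (r s) * x s = emb (r o0 * v s) * x o0" by metis
  have "eqm (r s) (v s) (E t s * v t)" if st: "s \<le> t" for s t
  proof -
    obtain c where c: "x s - emb (tr s t) * x t = emb (r o0 * c) * x o0" using diff[OF st] by blast
    have "emb (r t * (r o0 * c)) * x o0 = emb (r t) * (x s - emb (tr s t) * x t)"
      using c by (simp add: emb_mult mult_ac)
    also have "\<dots> = emb (q s t) * (emb (r s) * x s) - emb (tr s t) * (emb (r t) * x t)"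
      using q[OF st] by (simp add: emb_mult algebra_simps)
    also have "\<dots> = emb (q s t * (r o0 * v s) - tr s t * (r o0 * v t)) * x o0"
      unfolding v(2) by (simp add: emb_mult emb_diff algebra_simps)
    finally have "r t * (r o0 * c) = q s t * (r o0 * v s) - tr s t * (r o0 * v t)"
      using x0 by simp
    then have "(q s t * r o0) * (r s * c) = (q s t * r o0) * (v s - E t s * v t)"
      using q[OF st] by (simp add: tr_def algebra_simps)
    then have "r s * c = v s - E t s * v t" using q_nz[OF st] r_nz[of o0] by simp
    then show ?thesis unfolding eqm_def by (metis dvd_triv_left)
  qed
  then show ?thesis using v(1) that by blast
qed

end

theorem (in coherent_chain) nonstandard_module_exists:
  assumes no_thread: "\<nexists>v. (\<forall>s. v s dvd 1) \<and> (\<forall>s t. s \<le> t \<longrightarrow> eqm (r s) (v s) (E t s * v t))"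
    and inj: "inj (\<phi> :: 'i \<times> 'r \<Rightarrow> 'r)"
    and rep: "represents r J"
  shows "\<exists>(M :: 'r set set) add z sm.
           uniserial M add z sm \<and> \<not> standard M add z sm \<and> has_type M add z sm J Rset"
proof -
  \<comment> \<open>The classes of \<open>rel\<close> are copied along \<open>\<phi>\<close> to sets
    of ring elements, so that the carrier has type \<open>'r set set\<close>.\<close>
  define \<iota> where "\<iota> s a = \<phi> ` Collect (rel (s, a))" for s a
  have \<iota>_eq: "\<iota> s a = \<iota> t b \<longleftrightarrow> rel (s, a) (t, b)" for s t a b
  proof -
    have "Collect (rel (s, a)) = Collect (rel (t, b)) \<longleftrightarrow> rel (s, a) = rel (t, b)"
      by (auto dest: Collect_inj)
    also have "\<dots> \<longleftrightarrow> rel (s, a) (t, b)" using equivp_rel unfolding equivp_def by blast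
    finally show ?thesis unfolding \<iota>_def inj_image_eq_iff[OF inj] .
  qed
  interpret direct_limit r E \<iota>
  proof
    show "\<iota> s a = \<iota> s b \<longleftrightarrow> eqm (r s) a b" for s a b
      using rel_iff[of s s s] by (simp add: \<iota>_eq tr_refl)
    show "\<iota> s a = \<iota> t (tr s t * a)" if "s \<le> t" for s t a
      using rel_iff[OF that order_refl] by (simp add: \<iota>_eq tr_refl)
  qed
  have "\<not> standard carr uadd uzero usm"
  proof
    assume "standard carr uadd uzero usm"
    then obtain v where "\<And>s. v s dvd 1" "\<And>s t. s \<le> t \<Longrightarrow> eqm (r s) (v s) (E t s * v t)"
      by (rule thread_if_standard) (rule that)
    then show False using no_thread by blast
  qed
  then show ?thesis using uniserial_carr has_type_carr[OF rep] by (intro exI conjI)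
qed

section \<open>Chains of length \<open>\<omega>\<^sub>1\<close> and columns\<close>

lemma omega1_bounded:
  assumes "omega1_like TYPE('i::wellorder)" "countable (A :: 'i set)"
  obtains b where "\<And>a. a \<in> A \<Longrightarrow> a < b"
proof (rule ccontr)
  assume "\<not> thesis"
  then have "\<forall>b. \<exists>a\<in>A. b \<le> a" using that by (meson not_le)
  then have "UNIV \<subseteq> (\<Union>a\<in>A. insert a {y. y < a})" by (force simp: order_le_less)
  moreover have "countable (\<Union>a\<in>A. insert a {y. y < a})"
    using assms by (auto simp: omega1_like_def)
  ultimately show False using assms(1) countable_subset unfolding omega1_like_def by blast
qed

text \<open>By transfinite recursion \<open>g s\<close> is chosen above \<open>n\<close>,
  \<open>s\<close> and the countably many witnesses \<open>h (g t)\<close> with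
  \<open>t < s\<close>; upward closure of \<open>Q\<close> in its second argument does the
  rest.\<close>

lemma omega1_thin_out:
  fixes n :: "'i::wellorder"
  assumes om: "omega1_like TYPE('i)"
    and ex: "\<And>s :: 'i. \<exists>t>s. Q s t"
    and up: "\<And>s t u :: 'i. Q s t \<Longrightarrow> t \<le> u \<Longrightarrow> Q s u"
  obtains g :: "'i \<Rightarrow> 'i" where "\<And>s t. s < t \<Longrightarrow> g s < g t" "\<And>s t. s < t \<Longrightarrow> Q (g s) (g t)"
    "\<And>s. n \<le> g s" "\<And>s. s \<le> g s"
proof -
  define P where "P g s v \<longleftrightarrow> n \<le> v \<and> s \<le> v \<and> (\<forall>t<s. g t < v \<and> Q (g t) v)"
    for g :: "'i \<Rightarrow> 'i" and s v
  obtain h where h: "\<And>s. s < h s" "\<And>s. Q s (h s)" using ex by metis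
  have "\<exists>g. \<forall>s. P g s (g s)"
  proof (rule dependent_wf_choice[OF wf])
    show "P f x v = P g x v" if "\<And>z. (z, x) \<in> {(x, y). x < y} \<Longrightarrow> f z = g z" for f g x v
      using that by (simp add: P_def)
    fix s and g :: "'i \<Rightarrow> 'i"
    have "countable (insert n (insert s ((\<lambda>t. h (g t)) ` {t. t < s})))"
      using om by (simp add: omega1_like_def)
    then obtain b where b: "\<And>a. a \<in> insert n (insert s ((\<lambda>t. h (g t)) ` {t. t < s})) \<Longrightarrow> a < b"
      using omega1_bounded[OF om] by blast
    have "P g s b"
      unfolding P_def
    proof (intro conjI allI impI)
      show "n \<le> b" "s \<le> b" using b by (auto intro: less_imp_le)
      fix t assume "t < s"
      then have "h (g t) < b" using b by blast
      then show "g t < b" "Q (g t) b" using h less_trans up less_imp_le by metis+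
    qed
    then show "\<exists>v. P g s v" ..
  qed
  then obtain g where "\<And>s. P g s (g s)" by blast
  then show ?thesis using that[of g] by (simp add: P_def)
qed

lemma omega1_closure_point:
  fixes \<psi> :: "'i::wellorder \<Rightarrow> 'i"
  assumes om: "omega1_like TYPE('i)"
  obtains d where "is_limit d" "\<And>s. s < d \<Longrightarrow> \<psi> s < d"
proof -
  have "\<exists>b. x < b \<and> (\<forall>y\<le>x. \<psi> y < b)" for x
  proof -
    have "{y. y \<le> x} = insert x {y. y < x}" by (auto simp: order_le_less)
    then have "countable (insert x (\<psi> ` {y. y \<le> x}))"
      using om by (simp add: omega1_like_def)
    then obtain b where "\<And>a. a \<in> insert x (\<psi> ` {y. y \<le> x}) \<Longrightarrow> a < b" using omega1_bounded[OF om] by blast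
    then show ?thesis by blast
  qed
  then obtain b where b: "\<And>x. x < b x" "\<And>x y. y \<le> x \<Longrightarrow> \<psi> y < b x" by metis
  \<comment> \<open>The start of the iteration is arbitrary. Every element below the least strict
    upper bound of the iterates lies below an iterate, and the next iterate bounds its value under
    \<open>\<psi>\<close>.\<close>
  define a where "a n = (b ^^ n) undefined" for n
  have a: "a (Suc n) = b (a n)" for n by (simp add: a_def)
  have "countable (range a)" by simp
  then obtain u where u: "\<And>x. x \<in> range a \<Longrightarrow> x < u" using omega1_bounded[OF om] by blast
  define d where "d = (LEAST u. \<forall>n. a n < u)"
  have ad: "a n < d" for n unfolding d_def by (rule LeastI2[of _ u]) (use u in auto)
  have below: "\<exists>n. s \<le> a n" if "s < d" for s
    using not_less_Least[OF that[unfolded d_def]] by (auto simp: not_less)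
  have next_a: "s < a (Suc n)" "\<psi> s < a (Suc n)" if "s \<le> a n" for s n
    using that b a by (auto intro: le_less_trans)
  show ?thesis
  proof
    show "is_limit d" unfolding is_limit_def using ad below next_a by blast
    show "\<psi> s < d" if "s < d" for s using below[OF that] next_a ad less_trans by blast
  qed
qed

text \<open>The sequence dominates an enumeration of the predecessors of \<open>d\<close>. At a
  limit there is room to make each step strict.\<close>

lemma omega1_cofinal_seq:
  fixes d :: "'i::wellorder"
  assumes om: "omega1_like TYPE('i)" and "c < d"
  obtains s :: "nat \<Rightarrow> 'i" where "mono s" "\<And>k. s k < d" "\<And>x. x < d \<Longrightarrow> \<exists>k. x \<le> s k"
    "is_limit d \<Longrightarrow> strict_mono s"
proof -
  define a where "a = from_nat_into {y. y < d}"
  have ne: "{y. y < d} \<noteq> {}" using assms by blast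
  have co: "countable {y. y < d}" using om by (simp add: omega1_like_def)
  have a: "a n < d" for n using from_nat_into[OF ne] by (simp add: a_def)
  have a_onto: "\<exists>n. x = a n" if "x < d" for x
    using from_nat_into_surj[OF co, of x] that by (auto simp: a_def)
  have "\<exists>s. \<forall>n. (s n < d \<and> a n \<le> s n) \<and> (s n \<le> s (Suc n) \<and> (is_limit d \<longrightarrow> s n < s (Suc n)))"
  proof (rule dependent_nat_choice)
    show "\<exists>x. x < d \<and> a 0 \<le> x" using a by blast
    fix x n assume x: "x < d \<and> a n \<le> x"
    show "\<exists>y. (y < d \<and> a (Suc n) \<le> y) \<and> (x \<le> y \<and> (is_limit d \<longrightarrow> x < y))"
    proof (cases "is_limit d")
      case True
      moreover have "max x (a (Suc n)) < d" using x a by simp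
      ultimately obtain y where "max x (a (Suc n)) < y" "y < d" unfolding is_limit_def by blast
      then show ?thesis by (intro exI[of _ y]) auto
    next
      case False
      then show ?thesis using x a by (intro exI[of _ "max x (a (Suc n))"]) auto
    qed
  qed
  then obtain s where s: "\<And>n. s n < d" "\<And>n. a n \<le> s n" "\<And>n. s n \<le> s (Suc n)"
    "\<And>n. is_limit d \<Longrightarrow> s n < s (Suc n)" by blast
  show ?thesis
  proof
    show "mono s" using s(3) by (simp add: mono_iff_le_Suc)
    show "\<And>x. x < d \<Longrightarrow> \<exists>k. x \<le> s k" using a_onto s(2) by blast
    show "is_limit d \<Longrightarrow> strict_mono s" using s(4) by (simp add: strict_mono_Suc_iff)
  qed (rule s)
qed

text \<open>At each index only countably many values have been used, so recursion along omega_1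
  always finds a new element of \<open>S\<close>.\<close>

lemma omega1_lepoll_uncountable:
  assumes om: "omega1_like TYPE('i::wellorder)" and S: "uncountable (S :: 'i set)"
  shows "(UNIV :: 'i set) \<lesssim> S"
proof -
  have "\<exists>g. \<forall>s :: 'i. g s \<in> S \<and> g s \<notin> g ` {t. t < s}"
  proof (rule dependent_wf_choice[OF wf, where P = "\<lambda>g s v. v \<in> S \<and> v \<notin> g ` {t. t < s}"])
    show "(v \<in> S \<and> v \<notin> f ` {t. t < x}) = (v \<in> S \<and> v \<notin> g ` {t. t < x})"
      if "\<And>z. (z, x) \<in> {(x, y). x < y} \<Longrightarrow> f z = g z" for f g :: "'i \<Rightarrow> 'i" and x v
      using that by (auto simp: image_iff)
    fix s and g :: "'i \<Rightarrow> 'i"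
    have "countable (g ` {t. t < s})" using om by (simp add: omega1_like_def)
    then show "\<exists>v. v \<in> S \<and> v \<notin> g ` {t. t < s}" by (meson S countable_subset subsetI)
  qed
  then obtain g where "\<forall>s :: 'i. g s \<in> S \<and> g s \<notin> g ` {t. t < s}" ..
  then have g: "g s \<in> S" "t < s \<Longrightarrow> g s \<noteq> g t" for s t by auto
  have "inj g"
  proof (rule injI)
    show "x = y" if "g x = g y" for x y
      using that g(2)[of x y] g(2)[of y x] by (cases x y rule: linorder_cases) auto
  qed
  then show ?thesis using g(1) unfolding lepoll_def by blast
qed

text \<open>An injection of the sets of naturals would embed the reals in \<open>'i\<close>; their
  uncountable image there has the size of \<open>'i\<close>, so Schroeder-Bernstein would give
  CH.\<close>

lemma no_inj_of_not_CH:
  assumes om: "omega1_like TYPE('i::wellorder)"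
    and notCH: "\<not> ((UNIV :: 'i set) \<approx> (UNIV :: real set))"
    and card: "(UNIV :: 'r set) \<approx> (UNIV :: 'i set)"
  shows "\<not> inj (h :: nat set \<Rightarrow> 'r)"
proof
  assume "inj h"
  then have "(UNIV :: nat set set) \<lesssim> (UNIV :: 'r set)" unfolding lepoll_def by blast
  then have "(UNIV :: real set) \<lesssim> (UNIV :: 'i set)"
    using nat_sets_eqpoll_reals card by (meson eqpoll_imp_lepoll eqpoll_sym lepoll_trans)
  then obtain f :: "real \<Rightarrow> 'i" where f: "inj f" unfolding lepoll_def by blast
  have "uncountable (range f)" using f uncountable_UNIV_real countable_image_inj_on by blast
  then have "(UNIV :: 'i set) \<lesssim> range f" by (rule omega1_lepoll_uncountable[OF om])
  also have "range f \<lesssim> (UNIV :: real set)" by (rule image_lepoll)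
  finally show False using notCH \<open>(UNIV :: real set) \<lesssim> (UNIV :: 'i set)\<close> lepoll_antisym by blast
qed

text \<open>One representative for each residue class: the image of a set under \<open>rep d\<close>
  stands for its image in the quotient and serves to measure r_s R/r_t R.\<close>

definition rep :: "'r::idom \<Rightarrow> 'r \<Rightarrow> 'r" where
  "rep d x = (SOME y. eqm d y x)"

lemma rep_eqm: "eqm d (rep d x) x"
  unfolding rep_def by (rule someI[of _ x]) simp

lemma rep_eq_iff: "rep d x = rep d y \<longleftrightarrow> eqm d x y"
proof
  assume "rep d x = rep d y"
  then show "eqm d x y" using rep_eqm[of d x] rep_eqm[of d y] by (metis eqm_sym eqm_trans)
next
  assume "eqm d x y"
  then have "eqm d z x \<longleftrightarrow> eqm d z y" for z by (rule eqm_cong_iff[OF eqm_refl])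
  then show "rep d x = rep d y" by (simp add: rep_def)
qed

text \<open>Residues modulo \<open>b\<close> determine those modulo \<open>a\<close>; so an infinite
  or uncountable quotient stays so when the modulus is replaced by a multiple.\<close>

lemma rep_image_dvd:
  assumes "a dvd b" shows "rep a ` S = rep a ` (rep b ` S)"
proof -
  have "rep a x = rep a (rep b x)" for x
    unfolding rep_eq_iff by (rule eqm_sym[OF eqm_dvd[OF assms rep_eqm]])
  then show ?thesis unfolding image_image by (intro image_cong refl)
qed

section \<open>Columns and their construction along cofinal sequences\<close>

context val_chain
begin

text \<open>\<open>Y\<close> is an admissible column \<open>E d\<close> over the columns \<open>F t\<close> with \<open>t < d\<close>.\<close>

definition col :: "('i \<Rightarrow> 'i \<Rightarrow> 'r) \<Rightarrow> 'i \<Rightarrow> ('i \<Rightarrow> 'r) \<Rightarrow> bool" where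
  "col F d Y \<longleftrightarrow> Y d = 1 \<and> (\<forall>s\<le>d. Y s dvd 1) \<and> (\<forall>t<d. \<forall>s\<le>t. eqm (r s) (Y s) (F t s * Y t))"

lemma col_cong: "(\<And>t. t < d \<Longrightarrow> F t = G t) \<Longrightarrow> col F d Y = col G d Y"
  by (simp add: col_def)

lemma col_coherent:
  assumes "col F p (F p)" "s \<le> t" "t \<le> p"
  shows "eqm (r s) (F p s) (F t s * F p t)"
  using assms by (cases "t = p") (auto simp: col_def)

lemma coherent_chain_of_cols:
  assumes "\<And>d. col F d (F d)" shows "coherent_chain r F"
  by unfold_locales (use assms col_coherent in \<open>auto simp: col_def\<close>)

text \<open>Values \<open>X\<close> along a cofinal sequence, coherent from each term to the next,
  determine a column. The last clause gives exact values and later keeps \<open>Y\<close> inside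
  \<open>W\<close>.\<close>

lemma extend_col:
  fixes s :: "nat \<Rightarrow> 'i"
  assumes F: "\<And>t. t < d \<Longrightarrow> col F t (F t)"
    and s: "mono s" "\<And>k. s k < d" "\<And>x. x < d \<Longrightarrow> \<exists>k. x \<le> s k"
    and X: "\<And>k. X k dvd 1" "\<And>k. eqm (r (s k)) (X k) (F (s (Suc k)) (s k) * X (Suc k))"
  obtains Y where "col F d Y" "\<And>x k. x \<le> s k \<Longrightarrow> eqm (r x) (Y x) (F (s k) x * X k)"
    "\<And>x. x < d \<Longrightarrow> \<exists>k. x \<le> s k \<and> Y x = F (s k) x * X k"
proof -
  have smono: "s k \<le> s l" if "k \<le> l" for k l using s(1) that by (rule monoD)
  have coh: "eqm (r x) (F p x) (F t x * F p t)" if "x \<le> t" "t \<le> p" "p < d" for x t p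
    using col_coherent[OF F] that by blast
  have chain: "eqm (r (s k)) (X k) (F (s l) (s k) * X l)" if "k \<le> l" for k l
    using that
  proof (induction l rule: dec_induct)
    case base
    show ?case using F[OF s(2)] by (simp add: col_def)
  next
    case (step l)
    have "eqm (r (s k)) (X l) (F (s (Suc l)) (s l) * X (Suc l))"
      using eqm_dvd[OF r_dvd[OF smono] X(2)] step by blast
    then have "eqm (r (s k)) (F (s l) (s k) * X l) (F (s l) (s k) * (F (s (Suc l)) (s l) * X (Suc l)))"
      by (rule eqm_mult[OF eqm_refl])
    also have "eqm (r (s k)) \<dots> (F (s (Suc l)) (s k) * X (Suc l))"
      using eqm_mult[OF eqm_sym[OF coh[OF smono[OF step(1)] smono[of l "Suc l"] s(2)]] eqm_refl]
      by (simp add: mult.assoc)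
    finally show ?case using step.IH eqm_trans by blast
  qed
  have lev: "eqm (r x) (F (s k) x * X k) (F (s l) x * X l)" if x: "x \<le> s k" "k \<le> l" for x k l
  proof -
    have "eqm (r x) (F (s k) x * X k) (F (s k) x * (F (s l) (s k) * X l))"
      using eqm_dvd[OF r_dvd[OF x(1)] chain[OF x(2)]] by (rule eqm_mult[OF eqm_refl])
    also have "eqm (r x) \<dots> (F (s l) x * X l)"
      using eqm_mult[OF eqm_sym[OF coh[OF x(1) smono[OF x(2)] s(2)]] eqm_refl] by (simp add: mult.assoc)
    finally show ?thesis .
  qed
  define \<kappa> where "\<kappa> x = (LEAST k. x \<le> s k)" for x
  have \<kappa>: "x \<le> s (\<kappa> x)" if "x < d" for x unfolding \<kappa>_def using s(3)[OF that] by (rule LeastI_ex)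
  have \<kappa>_le: "\<kappa> x \<le> k" if "x \<le> s k" for x k unfolding \<kappa>_def using that by (rule Least_le)
  \<comment> \<open>The first term of the sequence at or above \<open>x\<close> is used; by
    \<open>lev\<close> later terms give the same modulo \<open>r x\<close>. The value 1 is required
    at \<open>d\<close> and a default beyond it.\<close>
  define Y where "Y x = (if x < d then F (s (\<kappa> x)) x * X (\<kappa> x) else 1)" for x
  have Y: "eqm (r x) (Y x) (F (s k) x * X k)" if "x \<le> s k" for x k
  proof -
    have "x < d" using that s(2) le_less_trans by blast
    then show ?thesis using lev[OF \<kappa> \<kappa>_le] that by (simp add: Y_def)
  qed
  show ?thesis
  proof (rule that)
    show "col F d Y" unfolding col_def
    proof (intro conjI allI impI)
      show "Y d = 1" by (simp add: Y_def)
      show "Y x dvd 1" if "x \<le> d" for x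
        using unit_mult[OF _ X(1)] F[OF s(2)] \<kappa>[of x] unfolding Y_def col_def by auto
      fix t x assume t: "t < d" and x: "x \<le> t"
      obtain k where k: "t \<le> s k" using s(3)[OF t] by blast
      have "eqm (r x) (Y x) (F (s k) x * X k)" using Y x k by simp
      also have "eqm (r x) \<dots> (F t x * F (s k) t * X k)"
        using eqm_mult[OF coh[OF x k s(2)] eqm_refl] .
      also have "eqm (r x) \<dots> (F t x * Y t)"
        using eqm_mult[OF eqm_refl eqm_dvd[OF r_dvd[OF x] eqm_sym[OF Y[OF k]]]] by (simp add: mult.assoc)
      finally show "eqm (r x) (Y x) (F t x * Y t)" .
    qed
    show "eqm (r x) (Y x) (F (s k) x * X k)" if "x \<le> s k" for x k using that by (rule Y)
    show "\<exists>k. x \<le> s k \<and> Y x = F (s k) x * X k" if "x < d" for x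
      using \<kappa>[OF that] that unfolding Y_def by auto
  qed
qed

end

section \<open>Uncountable quotients\<close>

context val_chain
begin

text \<open>The branches \<open>A\<close> of a binary tree give columns \<open>X A\<close> for which the elements \<open>h A\<close> that would
  complete them are pairwise distinct.\<close>

lemma escaping_col:
  assumes om: "omega1_like TYPE('i)"
    and unc: "\<And>s t. s < t \<Longrightarrow> uncountable (rep (r t) ` {x. r s dvd x})"
    and no_inj: "\<And>h :: nat set \<Rightarrow> 'r. \<not> inj h"
    and N: "countable N"
    and d: "is_limit d"
    and F: "\<And>t. t < d \<Longrightarrow> col F t (F t)"
  shows "\<exists>Y. col F d Y \<and> \<not> (\<exists>h. h dvd 1 \<and> (\<forall>s<d. \<exists>n\<in>N. eqm (r s) n (Y s * h)))"
proof (rule ccontr)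
  assume contr: "\<not> ?thesis"
  obtain c where "c < d" using d by (auto simp: is_limit_def)
  then obtain s :: "nat \<Rightarrow> 'i" where s: "mono s" "\<And>k. s k < d" "\<And>x. x < d \<Longrightarrow> \<exists>k. x \<le> s k"
    and "is_limit d \<Longrightarrow> strict_mono s" using omega1_cofinal_seq[OF om] by metis
  then have s_less: "s k < s (Suc k)" for k using d by (simp add: strict_mono_Suc_iff)
  define w where "w n = (SOME w. n * w = 1)" for n :: 'r
  have w: "n * w n = 1" if "n dvd 1" for n
    unfolding w_def using unit_inverse[OF that] by (metis (mono_tags, lifting) someI)
  \<comment> \<open>Only countably many residues \<open>w n * (n' - n)\<close> arise from
    \<open>N\<close>, whereas the multiples of \<open>r (s k)\<close> have uncountably many residues
    modulo the next generator; \<open>b\<close> takes one of the others.\<close>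
  have "\<exists>b. r (s k) dvd b \<and> (\<forall>n\<in>N. \<forall>n'\<in>N. n dvd 1 \<longrightarrow> \<not> eqm (r (s (Suc k))) (n * b) (n' - n))" for k
  proof -
    let ?R = "rep (r (s (Suc k)))"
    have "countable ((\<lambda>(n, n'). ?R (w n * (n' - n))) ` (N \<times> N))" using N by simp
    then have "\<not> ?R ` {x. r (s k) dvd x} \<subseteq> (\<lambda>(n, n'). ?R (w n * (n' - n))) ` (N \<times> N)"
      using unc[OF s_less] countable_subset by blast
    then obtain b where b: "r (s k) dvd b" "?R b \<notin> (\<lambda>(n, n'). ?R (w n * (n' - n))) ` (N \<times> N)" by blast
    have "\<not> eqm (r (s (Suc k))) (n * b) (n' - n)" if n: "n \<in> N" "n' \<in> N" "n dvd 1" for n n'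
    proof
      assume "eqm (r (s (Suc k))) (n * b) (n' - n)"
      then have "eqm (r (s (Suc k))) (w n * (n * b)) (w n * (n' - n))" by (rule eqm_mult[OF eqm_refl])
      moreover have "w n * (n * b) = b" using w[OF n(3)] by (metis mult.assoc mult.commute mult_1_left)
      ultimately have "?R b = ?R (w n * (n' - n))" by (simp add: rep_eq_iff)
      then show False using b(2) n by auto
    qed
    then show ?thesis using b(1) by blast
  qed
  then obtain b where b: "\<And>k. r (s k) dvd b k"
    and b_esc: "\<And>k n n'. n \<in> N \<Longrightarrow> n' \<in> N \<Longrightarrow> n dvd 1 \<Longrightarrow> \<not> eqm (r (s (Suc k))) (n * b k) (n' - n)"
    by metis
  have Fu: "F (s (Suc k)) (s k) dvd 1" for k
    using F[OF s(2)] s_less[of k] by (simp add: col_def less_imp_le)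
  \<comment> \<open>At stage \<open>k\<close> the branch \<open>A\<close> inserts the factor
    \<open>1 + b k\<close> or 1. Both are 1 modulo \<open>r (s k)\<close>, so consecutive terms are
    coherent either way.\<close>
  define X where "X A = rec_nat 1 (\<lambda>k x. w (F (s (Suc k)) (s k)) * x * (if k \<in> A then 1 + b k else 1))"
    for A :: "nat set"
  have X0: "X A 0 = 1" for A by (simp add: X_def)
  have XS: "X A (Suc k) = w (F (s (Suc k)) (s k)) * X A k * (if k \<in> A then 1 + b k else 1)" for A k
    by (simp add: X_def)
  have wu: "w n dvd 1" if "n dvd 1" for n using w[OF that] by (metis dvd_triv_right)
  have Xu: "X A k dvd 1" for A k
  proof (induction k)
    case (Suc k)
    show ?case unfolding XS using Suc wu[OF Fu] one_plus_unit[OF b] by (auto intro!: unit_mult)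
  qed (simp add: X0)
  have Xc: "eqm (r (s k)) (X A k) (F (s (Suc k)) (s k) * X A (Suc k))" for A k
  proof -
    have "F (s (Suc k)) (s k) * X A (Suc k) = X A k * (if k \<in> A then 1 + b k else 1)"
      unfolding XS using w[OF Fu[of k]] by (metis mult.assoc mult_1_left)
    then show ?thesis using b[of k] by (simp add: eqm_def algebra_simps)
  qed
  have Y_ex: "\<exists>Y. col F d Y \<and> (\<forall>k. eqm (r (s k)) (Y (s k)) (X A k))" for A
  proof -
    obtain Y where Y: "col F d Y" "\<And>x k. x \<le> s k \<Longrightarrow> eqm (r x) (Y x) (F (s k) x * X A k)"
      using extend_col[where X = "X A", OF F s Xu Xc] by metis
    have "F (s k) (s k) = 1" for k using F[OF s(2)] by (simp add: col_def)
    then have "eqm (r (s k)) (Y (s k)) (X A k)" for k using Y(2)[of "s k" k] by simp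
    then show ?thesis using Y(1) by blast
  qed
  have "\<exists>h. h dvd 1 \<and> (\<forall>k. \<exists>n\<in>N. eqm (r (s k)) n (X A k * h))" for A
  proof -
    obtain Y where Y: "col F d Y" "\<And>k. eqm (r (s k)) (Y (s k)) (X A k)"
      using Y_ex[of A] by blast
    have "\<exists>h. h dvd 1 \<and> (\<forall>s<d. \<exists>n\<in>N. eqm (r s) n (Y s * h))"
      by (rule ccontr, rule notE[OF contr], rule exI[of _ Y], rule conjI[OF Y(1)])
    then obtain h where h: "h dvd 1" "\<forall>x<d. \<exists>n\<in>N. eqm (r x) n (Y x * h)" by blast
    have "\<exists>n\<in>N. eqm (r (s k)) n (X A k * h)" for k
    proof -
      obtain n where n: "n \<in> N" "eqm (r (s k)) n (Y (s k) * h)" using h(2) s(2)[of k] by blast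
      show ?thesis using eqm_trans[OF n(2) eqm_mult[OF Y(2) eqm_refl]] n(1) by blast
    qed
    then show ?thesis using h(1) by blast
  qed
  then obtain h where h: "\<And>A. h A dvd 1" "\<And>A k. \<exists>n\<in>N. eqm (r (s k)) n (X A k * h A)" by metis
  \<comment> \<open>At the first place where the branches differ, equal completions would make
    \<open>n\<close> congruent to \<open>n' * (1 + b k)\<close> with \<open>n\<close> and
    \<open>n'\<close> in \<open>N\<close>, which the choice of \<open>b k\<close> excludes.\<close>
  have sep: "h A \<noteq> h B" if k: "k \<in> A" "k \<notin> B" "\<And>j. j < k \<Longrightarrow> j \<in> A \<longleftrightarrow> j \<in> B" for A B k
  proof
    assume eq: "h A = h B"
    have XX: "X A j = X B j" if "j \<le> k" for j
      using that by (induction j) (auto simp: X0 XS k(3))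
    have XAB: "X A (Suc k) * h A = X B (Suc k) * h B * (1 + b k)"
      using k eq XX[of k] by (simp add: XS mult_ac)
    obtain n where n: "n \<in> N" "eqm (r (s (Suc k))) n (X A (Suc k) * h A)" using h(2) by blast
    obtain n' where n': "n' \<in> N" "eqm (r (s (Suc k))) n' (X B (Suc k) * h B)" using h(2) by blast
    have "n' dvd 1" using unit_eqm[OF eqm_sym[OF n'(2)] unit_mult[OF Xu h(1)]] .
    have "eqm (r (s (Suc k))) (n' * (1 + b k)) (X B (Suc k) * h B * (1 + b k))"
      using eqm_mult[OF n'(2) eqm_refl] .
    then have "eqm (r (s (Suc k))) (n' * (1 + b k)) n"
      using eqm_sym[OF n(2)] unfolding XAB by (rule eqm_trans)
    then have "eqm (r (s (Suc k))) (n' * b k) (n - n')" by (simp add: eqm_def algebra_simps)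
    then show False using b_esc[OF n'(1) n(1) \<open>n' dvd 1\<close>] by blast
  qed
  have "inj h"
  proof (rule injI, rule ccontr)
    fix A B assume hAB: "h A = h B" and "A \<noteq> B"
    then have ex: "\<exists>k. (k \<in> A) \<noteq> (k \<in> B)" by blast
    define k where "k = (LEAST k. (k \<in> A) \<noteq> (k \<in> B))"
    have k: "(k \<in> A) \<noteq> (k \<in> B)" unfolding k_def using ex by (rule LeastI_ex)
    have below: "j \<in> A \<longleftrightarrow> j \<in> B" if "j < k" for j
      using not_less_Least[OF that[unfolded k_def]] by blast
    show False
    proof (cases "k \<in> A")
      case True
      then show False using sep[of k A B] k below hAB by blast
    next
      case False
      then show False using sep[of k B A] k below hAB by simp
    qed
  qed
  then show False using no_inj by blast
qed

text \<open>The same recursion without twisting factors: divide successively by the units of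
  \<open>F\<close>. At the least index the constant column 1 serves.\<close>

lemma any_col:
  assumes om: "omega1_like TYPE('i)" and F: "\<And>t. t < d \<Longrightarrow> col F t (F t)"
  shows "\<exists>Y. col F d Y"
proof (cases "\<exists>c. c < d")
  case False
  then show ?thesis by (intro exI[of _ "\<lambda>_. 1"]) (auto simp: col_def)
next
  case True
  then obtain s :: "nat \<Rightarrow> 'i" where s: "mono s" "\<And>k. s k < d" "\<And>x. x < d \<Longrightarrow> \<exists>k. x \<le> s k"
    using omega1_cofinal_seq[OF om] by metis
  define w where "w n = (SOME w. n * w = 1)" for n :: 'r
  have w: "n * w n = 1" if "n dvd 1" for n
    unfolding w_def using unit_inverse[OF that] by (metis (mono_tags, lifting) someI)
  define X where "X = rec_nat 1 (\<lambda>k x. w (F (s (Suc k)) (s k)) * x)"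
  have X: "X 0 = 1" "X (Suc k) = w (F (s (Suc k)) (s k)) * X k" for k by (simp_all add: X_def)
  have Fu: "F (s (Suc k)) (s k) dvd 1" for k
    using F[OF s(2)] monoD[OF s(1), of k "Suc k"] by (simp add: col_def)
  have "X k dvd 1" for k
  proof (induction k)
    case (Suc k)
    have "w (F (s (Suc k)) (s k)) dvd 1" using w[OF Fu] by (metis dvd_triv_right)
    then show ?case unfolding X using Suc by (rule unit_mult)
  qed (simp add: X)
  moreover have "eqm (r (s k)) (X k) (F (s (Suc k)) (s k) * X (Suc k))" for k
    unfolding X using w[OF Fu[of k]] by (simp add: mult.assoc[symmetric])
  ultimately show ?thesis using extend_col[OF F s] by metis
qed

theorem no_thread_uncountable:
  assumes om: "omega1_like TYPE('i)"
    and unc: "\<And>s t. s < t \<Longrightarrow> uncountable (rep (r t) ` {x. r s dvd x})"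
    and no_inj: "\<And>h :: nat set \<Rightarrow> 'r. \<not> inj h"
    and card: "(UNIV :: 'r set) \<approx> (UNIV :: 'i set)"
  shows "\<exists>E. coherent_chain r E \<and>
    (\<nexists>v. (\<forall>s. v s dvd 1) \<and> (\<forall>s t. s \<le> t \<longrightarrow> eqm (r s) (v s) (E t s * v t)))"
proof -
  obtain \<phi> :: "'r \<Rightarrow> 'i" where \<phi>: "inj \<phi>" using card unfolding eqpoll_def bij_betw_def by blast
  define N where "N d = {x. \<phi> x < d}" for d
  have N: "countable (N d)" for d
  proof -
    have "countable (\<phi> ` N d)"
      using om by (rule_tac countable_subset[of _ "{y. y < d}"]) (auto simp: N_def omega1_like_def)
    then show ?thesis by (rule countable_image_inj_on) (rule inj_on_subset[OF \<phi>], simp)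
  qed
  define P where "P F d Y \<longleftrightarrow> col F d Y \<and>
    (is_limit d \<longrightarrow> \<not> (\<exists>h. h dvd 1 \<and> (\<forall>s<d. \<exists>n\<in>N d. eqm (r s) n (Y s * h))))" for F d Y
  have "\<exists>F. \<forall>d. P F d (F d)"
  proof (rule dependent_wf_choice[OF wf])
    show "P F d Y = P G d Y" if "\<And>z. (z, d) \<in> {(x, y). x < y} \<Longrightarrow> F z = G z" for F G d Y
      using that col_cong[of d F G Y] by (simp add: P_def)
    fix d F assume "\<And>y. (y, d) \<in> {(x, y). x < y} \<Longrightarrow> P F y (F y)"
    then have F: "col F t (F t)" if "t < d" for t using that by (simp add: P_def)
    show "\<exists>Y. P F d Y"
    proof (cases "is_limit d")
      case True
      then show ?thesis using escaping_col[OF om unc no_inj N[of d] True F] by (simp add: P_def)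
    next
      case False
      then show ?thesis using any_col[OF om F] by (simp add: P_def)
    qed
  qed
  then obtain F where F: "\<And>d. P F d (F d)" by blast
  have "\<not> ((\<forall>s. v s dvd 1) \<and> (\<forall>s t. s \<le> t \<longrightarrow> eqm (r s) (v s) (F t s * v t)))" for v
  proof
    assume v: "(\<forall>s. v s dvd 1) \<and> (\<forall>s t. s \<le> t \<longrightarrow> eqm (r s) (v s) (F t s * v t))"
    \<comment> \<open>At a limit closed under \<open>s \<mapsto> \<phi> (v s)\<close> all earlier
      values of \<open>v\<close> lie in \<open>N d\<close>, so \<open>v d\<close> completes the
      column \<open>F d\<close> in the forbidden way.\<close>
    obtain d where d: "is_limit d" "\<And>s. s < d \<Longrightarrow> \<phi> (v s) < d"
      using omega1_closure_point[OF om, of "\<lambda>s. \<phi> (v s)"] by blast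
    have "\<exists>n\<in>N d. eqm (r s) n (F d s * v d)" if "s < d" for s
      using v d(2)[OF that] that by (intro bexI[of _ "v s"]) (auto simp: N_def)
    then show False using F[of d] v d(1) unfolding P_def by blast
  qed
  moreover have "coherent_chain r F" using F coherent_chain_of_cols by (simp add: P_def)
  ultimately show ?thesis by blast
qed

end

section \<open>Countable quotients\<close>

lemma rat_below_finite:
  fixes a :: rat
  assumes "finite Q" "\<And>q. q \<in> Q \<Longrightarrow> a < q"
  shows "\<exists>v>a. \<forall>q\<in>Q. v < q"
proof (cases "Q = {}")
  case True
  then show ?thesis by (simp add: gt_ex)
next
  case False
  then have "a < Min Q" using assms by simp
  then obtain v where "a < v" "v < Min Q" using dense by blast
  then show ?thesis using assms False by (intro exI[of _ v]) simp
qed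

section \<open>The tree of approximate threads and its labels\<close>

context val_chain
begin

text \<open>The group of units congruent to 1 modulo the first ideal of the chain;
  \<open>LEAST s. True\<close> is the least index. Its elements modulo \<open>r d\<close> are
  counted by the quotient of that ideal.\<close>

definition W :: "'r set" where
  "W = {u. eqm (r (LEAST s. True)) u 1}"

lemma bot_dvd: "r (LEAST s. True) dvd r s"
  by (rule r_dvd) (simp add: Least_le)

lemma W_one [simp]: "1 \<in> W"
  by (simp add: W_def)

lemma W_mult: "u \<in> W \<Longrightarrow> v \<in> W \<Longrightarrow> u * v \<in> W"
  unfolding W_def using eqm_mult[of _ u 1 v 1] by simp

lemma W_unit: assumes "u \<in> W" shows "u dvd 1"
  using assms unit_eqm[OF eqm_sym, of _ u 1] by (simp add: W_def)

lemma W_eqm: assumes "eqm (r s) u v" "u \<in> W" shows "v \<in> W"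
  using eqm_trans[OF eqm_sym[OF eqm_dvd[OF bot_dvd assms(1)]]] assms(2) by (simp add: W_def)

lemma W_inverse: assumes "u \<in> W" obtains w where "w \<in> W" "u * w = 1"
proof -
  obtain w where w: "u * w = 1" using unit_inverse[OF W_unit[OF assms]] by blast
  have "eqm (r (LEAST s. True)) (u * w) (1 * w)"
    using assms unfolding W_def by (intro eqm_mult) auto
  then have "w \<in> W" using w eqm_sym by (simp add: W_def)
  then show ?thesis using w that by blast
qed

lemma W_one_plus: "r s dvd b \<Longrightarrow> 1 + b \<in> W"
  by (rule W_eqm[of s 1]) (simp_all add: eqm_def)

text \<open>A node of the tree at level \<open>d\<close> is an element of \<open>W\<close> modulo \<open>r\<^sub>d R\<close>; a node \<open>h\<close> at
  level \<open>d\<close> lies above the node \<open>h * Y s\<close> at level \<open>s\<close>. The labels \<open>f s\<close> and \<open>g\<close> are strictly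
  increasing along the tree, and the last clause says that finitely many translates of a node
  can be extended simultaneously with arbitrarily small increase of the labels.\<close>

definition special_level ::
  "('i \<Rightarrow> 'i \<Rightarrow> 'r) \<Rightarrow> ('i \<Rightarrow> 'r \<Rightarrow> rat) \<Rightarrow> 'i \<Rightarrow> ('i \<Rightarrow> 'r) \<Rightarrow> ('r \<Rightarrow> rat) \<Rightarrow> bool" where
  "special_level F f d Y g \<longleftrightarrow> col F d Y \<and> (\<forall>s\<le>d. Y s \<in> W)
    \<and> (\<forall>u v. eqm (r d) u v \<longrightarrow> g u = g v)
    \<and> (\<forall>s<d. \<forall>h\<in>W. f s (h * Y s) < g h)
    \<and> (\<forall>s<d. \<forall>x\<in>W. \<forall>L. set L \<subseteq> W \<times> UNIV \<longrightarrow> (\<forall>(h, q)\<in>set L. f s (h * x) < q) \<longrightarrow>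
        (\<exists>y\<in>W. eqm (r s) (y * Y s) x \<and> (\<forall>(h, q)\<in>set L. g (h * y) < q)))"

lemma special_level_cong:
  assumes "\<And>t. t < d \<Longrightarrow> F t = F' t" "\<And>t. t < d \<Longrightarrow> f t = f' t"
  shows "special_level F f d Y g = special_level F' f' d Y g"
  using assms col_cong[of d F F' Y] by (simp add: special_level_def)

text \<open>A Rasiowa-Sikorski argument: requirements coded by residues modulo \<open>r d\<close>
  are met one after another by finite conditions. \<open>cnt\<close> makes them countable in number,
  and \<open>inf\<close> supplies nodes without a promised label.\<close>

lemma special_level_exists:
  assumes om: "omega1_like TYPE('i)"
    and cnt: "countable (rep (r d) ` {x. r (LEAST s. True) dvd x})"
    and inf: "\<And>s. s < d \<Longrightarrow> infinite (rep (r d) ` {x. r s dvd x})"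
    and sp: "\<And>t. t < d \<Longrightarrow> special_level F f t (F t) (f t)"
  shows "\<exists>Y g. special_level F f d Y g"
proof (cases "\<exists>c. c < d")
  case False
  then show ?thesis
    by (intro exI[of _ "\<lambda>_. 1"] exI[of _ "\<lambda>_. 0"]) (auto simp: special_level_def col_def)
next
  case True
  then obtain c where c: "c < d" by blast
  have F: "col F t (F t)" if "t < d" for t using sp[OF that] by (simp add: special_level_def)
  have F1: "F t t = 1" if "t < d" for t using F[OF that] by (simp add: col_def)
  have F_W: "F t s \<in> W" if "s \<le> t" "t < d" for s t
    using sp[OF that(2)] that(1) by (simp add: special_level_def)
  have f_cong: "f t u = f t v" if "t < d" "eqm (r t) u v" for t u v
    using sp[OF that(1)] that(2) by (simp add: special_level_def)
  have f_inc: "f s (h * F t s) \<le> f t h" if "s \<le> t" "t < d" "h \<in> W" for s t h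
  proof (cases "s = t")
    case False
    then show ?thesis using sp[OF that(2)] that by (simp add: special_level_def less_imp_le)
  qed (use F1 that in simp)
  have f_ext: "\<exists>y\<in>W. eqm (r s) (y * F t s) x \<and> (\<forall>(h, q)\<in>set L. f t (h * y) < q)"
    if "s \<le> t" "t < d" "x \<in> W" "set L \<subseteq> W \<times> UNIV" "\<forall>(h, q)\<in>set L. f s (h * x) < q" for s t x L
  proof (cases "s = t")
    case True
    then show ?thesis using that F1 by (intro bexI[of _ x]) auto
  next
    case False
    then have "s < t" using that by simp
    then show ?thesis using sp[OF that(2)] that(3-5) unfolding special_level_def by blast
  qed
  have coh: "eqm (r x) (F p x) (F t x * F p t)" if "x \<le> t" "t \<le> p" "p < d" for x t p
    using col_coherent[OF F] that by blast
  define K where "K = rep (r d)"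
  have K_eqm: "eqm (r d) (K u) u" for u unfolding K_def by (rule rep_eqm)
  have K_eq: "K u = K v \<longleftrightarrow> eqm (r d) u v" for u v unfolding K_def by (rule rep_eq_iff)
  have K_eqm_below: "eqm (r s) (K u) u" if "s < d" for s u
    using eqm_dvd[OF r_dvd K_eqm] that by simp
  have K_W: "K u \<in> W" if "u \<in> W" for u using W_eqm[OF eqm_sym[OF K_eqm] that] .

  \<comment> \<open>A condition approximates the column \<open>Y\<close> at one level and promises finitely many values of
    \<open>g\<close>; the column and its labels are read off a sufficiently generic sequence of conditions.\<close>
  define valid where "valid s X p \<longleftrightarrow> s < d \<and> X \<in> W \<and> finite (dom p)
      \<and> (\<forall>g q. p g = Some q \<longrightarrow> g \<in> W \<and> f s (g * X) < q)"
    for s X and p :: "'r \<Rightarrow> rat option"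

  \<comment> \<open>The simultaneous extension property of level \<open>s'\<close> is applied to the
    list of all promises, so that the level rises and no promise breaks.\<close>
  have advance: "\<exists>X'. valid s' X' p \<and> eqm (r s) X (X' * F s' s)"
    if v: "valid s X p" and s': "s \<le> s'" "s' < d" for s X p s'
  proof -
    have "{(g, q). p g = Some q} = (\<lambda>g. (g, the (p g))) ` dom p" by force
    then have "finite {(g, q). p g = Some q}" using v by (simp add: valid_def)
    then obtain L where L: "set L = {(g, q). p g = Some q}" using finite_list by blast
    have "set L \<subseteq> W \<times> UNIV" "\<forall>(h, q)\<in>set L. f s (h * X) < q" "X \<in> W"
      using v by (auto simp: L valid_def)
    then obtain y where y: "y \<in> W" "eqm (r s) (y * F s' s) X" "\<forall>(h, q)\<in>set L. f s' (h * y) < q"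
      using f_ext[OF s'] by blast
    then have "valid s' y p" using v s' by (auto simp: L valid_def)
    then show ?thesis using eqm_sym[OF y(2)] by blast
  qed

  have promise: "\<exists>p'. valid s X p' \<and> p \<subseteq>\<^sub>m p' \<and> g \<in> dom p'" if v: "valid s X p" and g: "g \<in> W" for s X p g
  proof (cases "g \<in> dom p")
    case False
    then have "p \<subseteq>\<^sub>m p(g \<mapsto> f s (g * X) + 1)" by (auto simp: map_le_def)
    moreover have "valid s X (p(g \<mapsto> f s (g * X) + 1))" using v g by (auto simp: valid_def)
    ultimately show ?thesis by (intro exI[of _ "p(g \<mapsto> f s (g * X) + 1)"]) simp
  qed (use v in auto)

  \<comment> \<open>For given \<open>h\<close> and \<open>g\<close> the equation
    \<open>K (h * (u * (1 + b))) = g\<close> fixes \<open>b\<close> modulo \<open>r d\<close>,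
    because \<open>h\<close> and \<open>u\<close> are units; finitely many pairs cannot exhaust
    infinitely many residues.\<close>
  have fresh: "\<exists>b. r s dvd b \<and> (\<forall>(h, q)\<in>set L. K (h * (u * (1 + b))) \<notin> dom p)"
    if v: "valid s X p" and u: "u \<in> W" and L: "set L \<subseteq> W \<times> UNIV"
    for s X p u and L :: "('r \<times> rat) list"
  proof (rule ccontr)
    assume contr: "\<not> ?thesis"
    define B where "B h g = {b. r s dvd b \<and> K (h * (u * (1 + b))) = g}" for h g
    have sub: "{x. r s dvd x} \<subseteq> (\<Union>h\<in>fst ` set L. \<Union>g\<in>dom p. B h g)"
      using contr by (fastforce simp: B_def)
    have "finite (K ` B h g)" if h: "h \<in> fst ` set L" for h g
    proof (cases "B h g = {}")
      case False
      then obtain b0 where b0: "b0 \<in> B h g" by blast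
      have "K b = K b0" if "b \<in> B h g" for b
      proof -
        have "eqm (r d) (h * (u * (1 + b))) (h * (u * (1 + b0)))"
          using b0 that by (simp add: B_def K_eq[symmetric])
        then have "eqm (r d) (1 + b) (1 + b0)"
          using h L u W_unit eqm_unit_cancel by (metis (no_types, lifting) SigmaE fst_conv imageE subsetD)
        then show ?thesis by (simp add: K_eq eqm_def)
      qed
      then have "K ` B h g \<subseteq> {K b0}" by blast
      then show ?thesis using finite_subset by blast
    qed simp
    then have "finite (K ` (\<Union>h\<in>fst ` set L. \<Union>g\<in>dom p. B h g))"
      using v by (simp add: image_UN valid_def)
    then have "finite (K ` {x. r s dvd x})" using finite_subset[OF image_mono[OF sub]] by blast
    then show False using inf v unfolding K_def valid_def by blast
  qed

  \<comment> \<open>Level \<open>s\<close> yields an extension \<open>z\<close> of \<open>x\<close>.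
    Dividing by \<open>X\<close> and multiplying by a fresh \<open>1 + b\<close> gives
    \<open>y\<close> with \<open>y * X\<close> congruent to \<open>z\<close> modulo
    \<open>r s\<close> and no node \<open>h * y\<close> promised yet; these nodes are then labelled
    within the bounds.\<close>
  have realise: "\<exists>p'. valid s X p' \<and> p \<subseteq>\<^sub>m p' \<and> (\<exists>y\<in>W. eqm (r t) (y * (F s t * X)) x \<and>
        (\<forall>(h, q)\<in>set L. \<exists>v. p' (K (h * y)) = Some v \<and> v < q))"
    if v: "valid s X p" and t: "t \<le> s" and x: "x \<in> W" and L: "set L \<subseteq> W \<times> UNIV"
      "\<forall>(h, q)\<in>set L. f t (h * x) < q" for s X p t x L
  proof -
    have s: "s < d" and X: "X \<in> W" using v by (auto simp: valid_def)
    obtain z where z: "z \<in> W" "eqm (r t) (z * F s t) x" "\<forall>(h, q)\<in>set L. f s (h * z) < q"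
      using f_ext[OF t s x L] by blast
    obtain X' where X': "X' \<in> W" "X * X' = 1" using W_inverse[OF X] by blast
    obtain b where b: "r s dvd b" "\<forall>(h, q)\<in>set L. K (h * (z * X' * (1 + b))) \<notin> dom p"
      using fresh[OF v W_mult[OF z(1) X'(1)] L(1)] by blast
    define y where "y = z * X' * (1 + b)"
    have yW: "y \<in> W" unfolding y_def by (intro W_mult z X' W_one_plus[OF b(1)])
    have "y * X = (X * X') * (z + z * b)" by (simp add: y_def algebra_simps)
    then have "y * X = z + z * b" using X' by simp
    then have yX: "eqm (r s) (y * X) z" using b(1) by (simp add: eqm_def)
    have "eqm (r t) (y * X * F s t) (z * F s t)"
      by (intro eqm_mult eqm_dvd[OF r_dvd[OF t] yX] eqm_refl)
    then have "eqm (r t) (y * X * F s t) x" using z(2) by (rule eqm_trans)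
    then have yx: "eqm (r t) (y * (F s t * X)) x" by (simp add: mult_ac)
    define new where "new = (\<lambda>(h, q). K (h * y)) ` set L"
    \<comment> \<open>Several \<open>h\<close> may lead to the same node \<open>g\<close>, so one
      value must respect all the bounds attached to it.\<close>
    have "\<exists>v. f s (g * X) < v \<and> (\<forall>(h, q)\<in>set L. K (h * y) = g \<longrightarrow> v < q)" for g
    proof -
      have "f s (g * X) < q" if "q \<in> {q. \<exists>h. (h, q) \<in> set L \<and> K (h * y) = g}" for q
      proof -
        obtain h where h: "(h, q) \<in> set L" "K (h * y) = g" using \<open>q \<in> _\<close> by blast
        have "eqm (r s) (K (h * y) * X) (h * y * X)" by (rule eqm_mult[OF K_eqm_below[OF s] eqm_refl])
        also have "eqm (r s) (h * y * X) (h * z)"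
          using eqm_mult[OF eqm_refl yX, of h] by (simp add: mult.assoc)
        finally have "f s (g * X) = f s (h * z)" using f_cong[OF s] h(2) by simp
        then show ?thesis using z(3) h(1) by auto
      qed
      moreover have "finite {q. \<exists>h. (h, q) \<in> set L \<and> K (h * y) = g}"
        by (rule finite_subset[of _ "snd ` set L"]) force+
      ultimately have "\<exists>v>f s (g * X). \<forall>q\<in>{q. \<exists>h. (h, q) \<in> set L \<and> K (h * y) = g}. v < q"
        by (intro rat_below_finite)
      then show ?thesis by auto
    qed
    then obtain val where val: "\<And>g. f s (g * X) < val g"
      "\<And>g. \<forall>(h, q)\<in>set L. K (h * y) = g \<longrightarrow> val g < q" by metis
    define p' where "p' g = (if g \<in> new then Some (val g) else p g)" for g
    have "dom p' \<subseteq> new \<union> dom p" by (auto simp: p'_def split: if_splits)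
    moreover have "finite new" by (simp add: new_def)
    ultimately have "finite (dom p')" using v finite_subset unfolding valid_def by blast
    moreover have "g \<in> W" if "g \<in> new" for g
      using that L(1) by (auto simp: new_def intro!: K_W W_mult yW)
    ultimately have "valid s X p'" using v val(1) by (auto simp: valid_def p'_def)
    moreover have "p \<subseteq>\<^sub>m p'" using b(2) by (auto simp: map_le_def p'_def new_def y_def)
    moreover have "\<forall>(h, q)\<in>set L. \<exists>v. p' (K (h * y)) = Some v \<and> v < q"
      using val(2) by (fastforce simp: p'_def new_def)
    ultimately show ?thesis using yW yx by blast
  qed

  \<comment> \<open>A task \<open>(t, x, L, g)\<close> asks to reach level \<open>t\<close>, to
    label \<open>g\<close> and, if the bounds in \<open>L\<close> are admissible, to realise the
    extension problem for \<open>x\<close> and \<open>L\<close>. Using only representatives modulo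
    \<open>r d\<close> keeps \<open>C\<close> countable.\<close>
  define C where "C = {t. t < d} \<times> K ` W \<times> lists (K ` W \<times> (UNIV :: rat set)) \<times> K ` W"
  have "K ` W \<subseteq> (\<lambda>c. K (1 + c)) ` K ` {x. r (LEAST s. True) dvd x}"
  proof
    fix k assume "k \<in> K ` W"
    then obtain u where u: "k = K u" "r (LEAST s. True) dvd u - 1" by (auto simp: W_def eqm_def)
    have "K u = K (1 + K (u - 1))"
      using K_eqm[of "u - 1"] by (simp add: K_eq eqm_def algebra_simps) (metis dvd_minus_iff minus_diff_eq)
    then show "k \<in> (\<lambda>c. K (1 + c)) ` K ` {x. r (LEAST s. True) dvd x}" using u by auto
  qed
  moreover have "countable ((\<lambda>c. K (1 + c)) ` K ` {x. r (LEAST s. True) dvd x})"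
    using countable_image[OF cnt] by (simp only: K_def)
  ultimately have "countable (K ` W)" by (rule countable_subset)
  then have C: "countable C" unfolding C_def using om by (simp add: omega1_like_def)
  have C_ne: "C \<noteq> {}" unfolding C_def using c W_one by blast
  define D where "D c q \<longleftrightarrow> (case (c, q) of ((t, x, L, g), (s, X, p)) \<Rightarrow> t \<le> s \<and> g \<in> dom p \<and>
     ((\<forall>(h, q)\<in>set L. f t (h * x) < q) \<longrightarrow> (\<exists>y\<in>W. eqm (r t) (y * (F s t * X)) x \<and>
        (\<forall>(h, q)\<in>set L. \<exists>v. p (K (h * y)) = Some v \<and> v < q))))" for c q
  have "\<exists>q. \<forall>n. (case q n of (s, X, p) \<Rightarrow> valid s X p) \<and>
      ((case (q n, q (Suc n)) of ((s, X, p), (s', X', p')) \<Rightarrow> s \<le> s' \<and> eqm (r s) X (X' * F s' s) \<and> p \<subseteq>\<^sub>m p')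
        \<and> D (from_nat_into C n) (q (Suc n)))"
  proof (rule dependent_nat_choice)
    show "\<exists>q. case q of (s, X, p) \<Rightarrow> valid s X p"
      by (intro exI[of _ "(c, 1, Map.empty)"]) (simp add: valid_def c)
    fix q :: "'i \<times> 'r \<times> ('r \<Rightarrow> rat option)" and n
    assume "case q of (s, X, p) \<Rightarrow> valid s X p"
    then obtain s X p where q: "q = (s, X, p)" and v: "valid s X p" by (cases q) auto
    obtain t x L g where task: "from_nat_into C n = (t, x, L, g)" by (metis prod_cases4)
    have "(t, x, L, g) \<in> C" using from_nat_into[OF C_ne, of n] task by simp
    then have t: "t < d" and x: "x \<in> W" and g: "g \<in> W" and L: "set L \<subseteq> W \<times> UNIV"
      using K_W by (auto simp: C_def lists_eq_set)
    define s' where "s' = max s t"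
    have s': "s \<le> s'" "t \<le> s'" "s' < d" using t v by (auto simp: s'_def valid_def)
    obtain X' where X': "valid s' X' p" "eqm (r s) X (X' * F s' s)" using advance[OF v s'(1,3)] by blast
    obtain p1 where p1: "valid s' X' p1" "p \<subseteq>\<^sub>m p1" "g \<in> dom p1" using promise[OF X'(1) g] by blast
    obtain p2 where p2: "valid s' X' p2" "p1 \<subseteq>\<^sub>m p2"
      "(\<forall>(h, q)\<in>set L. f t (h * x) < q) \<longrightarrow> (\<exists>y\<in>W. eqm (r t) (y * (F s' t * X')) x \<and>
        (\<forall>(h, q)\<in>set L. \<exists>v. p2 (K (h * y)) = Some v \<and> v < q))"
    proof (cases "\<forall>(h, q)\<in>set L. f t (h * x) < q")
      case True
      then show ?thesis using realise[OF p1(1) s'(2) x L True] that by blast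
    next
      case False
      show ?thesis by (rule that[OF p1(1) map_le_refl], rule impI, rule notE[OF False])
    qed
    have "g \<in> dom p2" using p1(3) p2(2) map_le_implies_dom_le by blast
    moreover have "p \<subseteq>\<^sub>m p2" using p1(2) p2(2) map_le_trans by blast
    ultimately show "\<exists>q'. (case q' of (s, X, p) \<Rightarrow> valid s X p) \<and>
        ((case (q, q') of ((s, X, p), (s', X', p')) \<Rightarrow> s \<le> s' \<and> eqm (r s) X (X' * F s' s) \<and> p \<subseteq>\<^sub>m p')
          \<and> D (from_nat_into C n) q')"
      using p2(1,3) X'(2) s'(1,2) by (intro exI[of _ "(s', X', p2)"]) (simp add: q D_def task)
  qed
  then obtain q where q': "\<forall>n. (case q n of (s, X, p) \<Rightarrow> valid s X p) \<and>
      ((case (q n, q (Suc n)) of ((s, X, p), (s', X', p')) \<Rightarrow> s \<le> s' \<and> eqm (r s) X (X' * F s' s) \<and> p \<subseteq>\<^sub>m p')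
        \<and> D (from_nat_into C n) (q (Suc n)))" ..
  note q = conjunct1[OF spec[OF q']] conjunct1[OF conjunct2[OF spec[OF q']]]
    conjunct2[OF conjunct2[OF spec[OF q']]]
  define S where "S n = fst (q n)" for n
  define X where "X n = fst (snd (q n))" for n
  define p where "p n = snd (snd (q n))" for n
  have q_eq: "q n = (S n, X n, p n)" for n by (simp add: S_def X_def p_def)
  have val: "valid (S n) (X n) (p n)" for n using q(1)[of n] by (simp add: q_eq)
  have Sd: "S n < d" and XW: "X n \<in> W" for n using val[of n] by (auto simp: valid_def)
  have step: "S n \<le> S (Suc n)" "eqm (r (S n)) (X n) (F (S (Suc n)) (S n) * X (Suc n))" "p n \<subseteq>\<^sub>m p (Suc n)" for n
    using q(2)[of n] by (simp_all add: q_eq mult.commute)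
  have S_mono: "mono S" using step(1) by (simp add: mono_iff_le_Suc)
  have p_mono: "p m \<subseteq>\<^sub>m p n" if "m \<le> n" for m n
    using that by (induction n rule: dec_induct) (use step(3) map_le_trans in \<open>auto\<close>)
  have task: "\<exists>n. D c (S n, X n, p n)" if "c \<in> C" for c
    using q(3) from_nat_into_surj[OF C that] by (metis q_eq)
  \<comment> \<open>A task with empty list, used for the level that it forces.\<close>
  have S_cof: "\<exists>n. x \<le> S n" if "x < d" for x
    using task[of "(x, K 1, [], K 1)"] that by (auto simp: C_def D_def)
  obtain Y where Y: "col F d Y" "\<And>x k. x \<le> S k \<Longrightarrow> eqm (r x) (Y x) (F (S k) x * X k)"
    "\<And>x. x < d \<Longrightarrow> \<exists>k. x \<le> S k \<and> Y x = F (S k) x * X k"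
    using extend_col[where X = X, OF F S_mono Sd S_cof W_unit[OF XW] step(2)] by metis
  \<comment> \<open>The union of the promises. They only grow along the sequence, so
    \<open>K u\<close> never gets two labels; the tasks provide one for each \<open>u\<close> in
    \<open>W\<close>.\<close>
  define g where "g u = (SOME v. \<exists>n. p n (K u) = Some v)" for u
  have g_eq: "g u = v" if "p n (K u) = Some v" for n u v
  proof -
    have uniq: "v' = v" if "p m (K u) = Some v'" for m v'
    proof -
      have "p (max m n) (K u) = Some v" "p (max m n) (K u) = Some v'"
        using p_mono[of n "max m n"] p_mono[of m "max m n"] that \<open>p n (K u) = Some v\<close>
        by (auto simp: map_le_def) (metis domI)+
      then show ?thesis by simp
    qed
    show ?thesis unfolding g_def
    proof (rule some_equality)
      show "\<exists>n. p n (K u) = Some v" using that by blast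
      show "v' = v" if "\<exists>n. p n (K u) = Some v'" for v' using that uniq by blast
    qed
  qed
  have "special_level F f d Y g"
    unfolding special_level_def
  proof (intro conjI allI impI ballI)
    show "col F d Y" by (rule Y)
    show "Y s \<in> W" if "s \<le> d" for s
    proof (cases "s = d")
      case True
      then show ?thesis using Y(1) by (simp add: col_def)
    next
      case False
      then have "s < d" using that by simp
      then obtain k where "s \<le> S k" "Y s = F (S k) s * X k" using Y(3) by blast
      then show ?thesis using F_W Sd XW W_mult by simp
    qed
    show "g u = g v" if "eqm (r d) u v" for u v
      using that unfolding K_eq[symmetric] by (simp add: g_def)
  next
    fix s h assume s: "s < d" and h: "h \<in> W"
    obtain m where m: "K h \<in> dom (p m)" using task[of "(c, K 1, [], K h)"] c h by (auto simp: C_def D_def)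
    obtain m' where m': "s \<le> S m'" using S_cof[OF s] by blast
    define n where "n = max m m'"
    have n: "K h \<in> dom (p n)" "s \<le> S n"
      using p_mono[of m n] m m' monoD[OF S_mono, of m' n]
      by (auto simp: n_def dest: map_le_implies_dom_le)
    then obtain v where v: "p n (K h) = Some v" by blast
    have "eqm (r s) (h * Y s) (K h * X n * F (S n) s)"
      using eqm_mult[OF eqm_sym[OF K_eqm_below[OF s, of h]] Y(2)[OF n(2)]] by (simp add: mult_ac)
    then have "f s (h * Y s) = f s (K h * X n * F (S n) s)" by (rule f_cong[OF s])
    also have "\<dots> \<le> f (S n) (K h * X n)" using f_inc[OF n(2) Sd] W_mult[OF K_W[OF h] XW] by blast
    also have "\<dots> < v" using val[of n] v by (simp add: valid_def)
    also have "v = g h" using g_eq[OF v] by simp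
    finally show "f s (h * Y s) < g h" .
  next
    fix s x and L :: "('r \<times> rat) list"
    assume s: "s < d" and x: "x \<in> W" and L: "set L \<subseteq> W \<times> UNIV" "\<forall>(h, q)\<in>set L. f s (h * x) < q"
    \<comment> \<open>Passing to representatives turns the problem into one of the tasks; labels
      \<open>f s\<close> and congruences modulo \<open>r s\<close> do not change, since
      \<open>r s\<close> divides \<open>r d\<close>.\<close>
    define L' where "L' = map (\<lambda>(h, q). (K h, q)) L"
    have "(s, K x, L', K 1) \<in> C" using s x L(1) by (auto simp: C_def L'_def intro!: imageI)
    then obtain n where n: "D (s, K x, L', K 1) (S n, X n, p n)" using task by blast
    have "\<forall>(h, q)\<in>set L'. f s (h * K x) < q"
    proof -
      have "f s (K h * K x) = f s (h * x)" for h
        by (rule f_cong[OF s]) (intro eqm_mult K_eqm_below[OF s])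
      then show ?thesis using L(2) by (auto simp: L'_def)
    qed
    then obtain y where sn: "s \<le> S n" and y: "y \<in> W" "eqm (r s) (y * (F (S n) s * X n)) (K x)"
      "\<forall>(h, q)\<in>set L'. \<exists>v. p n (K (h * y)) = Some v \<and> v < q"
      using n unfolding D_def by auto
    have "eqm (r s) (y * Y s) (y * (F (S n) s * X n))" by (rule eqm_mult[OF eqm_refl Y(2)[OF sn]])
    also note y(2)
    also note K_eqm_below[OF s, of x]
    finally have yx: "eqm (r s) (y * Y s) x" .
    have "g (h * y) < q" if hq: "(h, q) \<in> set L" for h q
    proof -
      have "(K h, q) \<in> set L'" using hq by (force simp: L'_def)
      then obtain v where v: "p n (K (K h * y)) = Some v" "v < q" using y(3) by blast
      have "K (K h * y) = K (h * y)" unfolding K_eq by (rule eqm_mult[OF K_eqm eqm_refl])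
      then show ?thesis using g_eq v by simp
    qed
    then show "\<exists>y\<in>W. eqm (r s) (y * Y s) x \<and> (\<forall>(h, q)\<in>set L. g (h * y) < q)"
      using y(1) yx by blast
  qed
  then show ?thesis by blast
qed

theorem no_thread_countable:
  assumes om: "omega1_like TYPE('i)"
    and cnt: "\<And>d. countable (rep (r d) ` {x. r (LEAST s. True) dvd x})"
    and inf: "\<And>s d. s < d \<Longrightarrow> infinite (rep (r d) ` {x. r s dvd x})"
  shows "\<exists>E. coherent_chain r E \<and>
    (\<nexists>v. (\<forall>s. v s dvd 1) \<and> (\<forall>s t. s \<le> t \<longrightarrow> eqm (r s) (v s) (E t s * v t)))"
proof -
  define P where "P G d c \<longleftrightarrow> special_level (\<lambda>t. fst (G t)) (\<lambda>t. snd (G t)) d (fst c) (snd c)"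
    for G :: "'i \<Rightarrow> ('i \<Rightarrow> 'r) \<times> ('r \<Rightarrow> rat)" and d c
  have "\<exists>G. \<forall>d. P G d (G d)"
  proof (rule dependent_wf_choice[OF wf])
    show "P G d c = P G' d c" if "\<And>z. (z, d) \<in> {(x, y). x < y} \<Longrightarrow> G z = G' z" for G G' d c
      unfolding P_def by (rule special_level_cong) (use that in auto)
    fix d G assume "\<And>y. (y, d) \<in> {(x, y). x < y} \<Longrightarrow> P G y (G y)"
    then have "special_level (\<lambda>t. fst (G t)) (\<lambda>t. snd (G t)) t (fst (G t)) (snd (G t))" if "t < d" for t
      using that by (simp add: P_def)
    then show "\<exists>c. P G d c"
      using special_level_exists[OF om cnt inf, of d "\<lambda>t. fst (G t)" "\<lambda>t. snd (G t)"] by (simp add: P_def)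
  qed
  then obtain G where G: "\<And>d. P G d (G d)" by blast
  define E where "E t = fst (G t)" for t
  define f where "f t = snd (G t)" for t
  have sp: "special_level E f d (E d) (f d)" for d using G[of d] by (simp add: P_def E_def[abs_def] f_def[abs_def])
  have "\<not> ((\<forall>s. v s dvd 1) \<and> (\<forall>s t. s \<le> t \<longrightarrow> eqm (r s) (v s) (E t s * v t)))" for v
  proof
    assume v: "(\<forall>s. v s dvd 1) \<and> (\<forall>s t. s \<le> t \<longrightarrow> eqm (r s) (v s) (E t s * v t))"
    \<comment> \<open>Scaling by the inverse of the value at the least index moves the thread into
      \<open>W\<close>, where the labels increase strictly.\<close>
    define o0 :: 'i where "o0 = (LEAST s. True)"
    have "v o0 dvd 1" using v by blast
    then obtain u where u: "v o0 * u = 1" using unit_inverse by blast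
    have W: "u * v t \<in> W" for t
    proof -
      have o0: "o0 \<le> t" by (simp add: o0_def Least_le)
      then have "E t o0 \<in> W" using sp[of t] by (simp add: special_level_def)
      then have "eqm (r o0) (E t o0 * v t) (1 * v t)" unfolding W_def o0_def by (intro eqm_mult) auto
      moreover have "eqm (r o0) (v o0) (E t o0 * v t)" using v o0 by blast
      ultimately have "eqm (r o0) (v o0) (1 * v t)" by (rule eqm_trans[rotated])
      then have "eqm (r o0) (v o0) (v t)" by simp
      then have "eqm (r o0) (v o0 * u) (v t * u)" by (intro eqm_mult) auto
      then show ?thesis using u eqm_sym by (simp add: W_def o0_def mult.commute)
    qed
    have "f s (u * v s) < f t (u * v t)" if st: "s < t" for s t
    proof -
      have "eqm (r s) (v s) (E t s * v t)" using v st less_imp_le by blast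
      then have "eqm (r s) (u * v s) (u * (E t s * v t))" by (rule eqm_mult[OF eqm_refl])
      then have "f s (u * v s) = f s (u * v t * E t s)"
        using sp[of s] unfolding special_level_def by (simp add: mult_ac)
      also have "\<dots> < f t (u * v t)" using sp[of t] W st unfolding special_level_def by blast
      finally show ?thesis .
    qed
    then have "strict_mono (\<lambda>s. f s (u * v s))" by (rule strict_monoI)
    then have "inj (\<lambda>s. f s (u * v s))" by (rule strict_mono_imp_inj_on)
    then have "countable (UNIV :: 'i set)" by (rule countable_image_inj_on[OF countableI_type])
    then show False using om by (simp add: omega1_like_def)
  qed
  moreover have "coherent_chain r E"
    by (rule coherent_chain_of_cols) (use sp in \<open>simp add: special_level_def\<close>)
  ultimately show ?thesis by blast
qed

end

section \<open>Reduction to the two cases\<close>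

text \<open>If the ideals were constant from \<open>s\<close> on, the topology at a limit
  \<open>d > s\<close> would be discrete and Cauchy sequences eventually constant in the quotient.
  So \<open>Gamma_set r\<close> would miss the cub of all \<open>d > s\<close>.\<close>

lemma stationary_Gamma_strict:
  fixes r :: "'i::wellorder \<Rightarrow> 'r::idom"
  assumes om: "omega1_like TYPE('i)" and dvd: "\<And>s t. s < t \<Longrightarrow> r s dvd r t"
    and Gamma: "stationary (Gamma_set r)"
  shows "\<exists>t>s. \<not> r t dvd r s"
proof (rule ccontr)
  assume "\<not> ?thesis"
  then have stab: "r t dvd r s" for t
    using dvd by (metis dvd_refl linorder_neqE)
  have "cub {d. s < d}"
    unfolding cub_def
  proof (intro conjI allI impI)
    fix a
    have "countable {a, s}" by simp
    then obtain b where "\<And>x. x \<in> {a, s} \<Longrightarrow> x < b" using omega1_bounded[OF om] by blast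
    then show "\<exists>c\<in>{d. s < d}. a < c" by auto
  next
    fix d assume "is_limit d \<and> (\<forall>b<d. \<exists>c\<in>{d. s < d}. b < c \<and> c < d)"
    then show "d \<in> {d. s < d}" unfolding is_limit_def by (auto intro: less_trans)
  qed
  then obtain d where d: "d \<in> Gamma_set r" "s < d" using Gamma unfolding stationary_def by blast
  have "quot_complete r d"
    unfolding quot_complete_def
  proof (intro allI impI)
    fix x :: "nat \<Rightarrow> 'r"
    assume x: "\<forall>s<d. \<exists>N. \<forall>m\<ge>N. \<forall>n\<ge>N. r s dvd x m - x n"
    then obtain N where "\<forall>m\<ge>N. \<forall>n\<ge>N. r s dvd x m - x n" using d by blast
    then have "r t dvd x n - x N" if "n \<ge> N" for t n using that stab dvd_trans by blast
    then show "\<exists>y. \<forall>s<d. \<exists>N. \<forall>n\<ge>N. r s dvd x n - y" by blast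
  qed
  then show False using d by (simp add: Gamma_set_def)
qed

text \<open>Take \<open>t\<close> above omega many strict steps that start at \<open>s\<close>. The
  generators \<open>r (a n)\<close> are distinct modulo \<open>r t\<close>, since a coincidence
  would make \<open>r (a (Suc m))\<close> divide \<open>r (a m)\<close>.\<close>

lemma infinite_step:
  fixes r :: "'i::wellorder \<Rightarrow> 'r::idom"
  assumes om: "omega1_like TYPE('i)"
    and dvd: "\<And>s t. s < t \<Longrightarrow> r s dvd r t"
    and strict: "\<And>s. \<exists>t>s. \<not> r t dvd r s"
  shows "\<exists>t>s. infinite (rep (r t) ` {x. r s dvd x})"
proof -
  obtain h where h: "\<And>s. s < h s" "\<And>s. \<not> r (h s) dvd r s" using strict by metis
  define a where "a n = (h ^^ n) s" for n
  have aS: "a (Suc n) = h (a n)" for n by (simp add: a_def)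
  have a_mono: "strict_mono a" using h(1) by (simp add: strict_mono_Suc_iff aS)
  have "countable (range a)" by simp
  then obtain t where t: "\<And>x. x \<in> range a \<Longrightarrow> x < t" using omega1_bounded[OF om] by blast
  have le_dvd: "r u dvd r v" if "u \<le> v" for u v using that dvd by (cases "u = v") auto
  have neq: "rep (r t) (r (a m)) \<noteq> rep (r t) (r (a n))" if mn: "m < n" for m n
  proof
    assume "rep (r t) (r (a m)) = rep (r t) (r (a n))"
    then have "r t dvd r (a m) - r (a n)" by (simp add: rep_eq_iff eqm_def)
    moreover have "r (a (Suc m)) dvd r t" using t by (intro dvd) simp
    moreover have "r (a (Suc m)) dvd r (a n)"
      using mn a_mono by (intro le_dvd) (simp add: strict_mono_less_eq)
    ultimately have "r (a (Suc m)) dvd r (a m)" by (metis dvd_trans dvd_diff_left_iff dvd_add diff_add_cancel)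
    then show False using h(2) by (simp add: aS)
  qed
  have "inj (\<lambda>n. rep (r t) (r (a n)))"
    by (rule linorder_injI) (use neq in blast)
  then have "infinite (range (\<lambda>n. rep (r t) (r (a n))))" using range_inj_infinite by blast
  moreover have "range (\<lambda>n. rep (r t) (r (a n))) \<subseteq> rep (r t) ` {x. r s dvd x}"
  proof -
    have "a 0 = s" by (simp add: a_def)
    then have "s \<le> a n" for n using strict_mono_less_eq[OF a_mono, of 0 n] by simp
    then show ?thesis using le_dvd by blast
  qed
  ultimately have "infinite (rep (r t) ` {x. r s dvd x})" using infinite_super by blast
  moreover have "s < t" using t[OF rangeI, of 0] by (simp add: a_def)
  ultimately show ?thesis by blast
qed

lemma represents_subchain:
  fixes r :: "'i::wellorder \<Rightarrow> 'r::idom"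
  assumes rep: "represents r J" and g: "\<And>s t. s < t \<Longrightarrow> g s < g t" "\<And>s. s \<le> g s"
  shows "represents (\<lambda>s. r (g s)) J"
proof -
  have dvd: "r s dvd r t" if "s \<le> t" for s t
    using rep that by (cases "s = t") (auto simp: represents_def)
  have nz: "r s \<noteq> 0" for s using rep by (simp add: represents_def)
  have "invR (r s) \<subseteq> invR (r (g s))" for s by (rule invR_mono[OF dvd[OF g(2)] nz])
  then have "(\<Union>s. invR (r s)) = (\<Union>s. invR (r (g s)))" by blast
  then show ?thesis using rep g(1) unfolding represents_def by simp
qed

lemma val_chain_of_represents:
  fixes r :: "'i::wellorder \<Rightarrow> 'r::idom"
  assumes "\<And>a b :: 'r. a dvd b \<or> b dvd a" "represents r J" "\<And>s. \<not> r s dvd 1"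
  shows "val_chain r"
proof
  show "r s dvd r t" if "s \<le> t" for s t
    using assms(2) that by (cases "s = t") (auto simp: represents_def)
qed (use assms in \<open>auto simp: represents_def\<close>)

lemma coherent_chain_without_thread:
  fixes r :: "'i::wellorder \<Rightarrow> 'r::idom"
  assumes om: "omega1_like TYPE('i)"
    and no_inj: "\<And>h :: nat set \<Rightarrow> 'r. \<not> inj h"
    and tot: "\<And>a b :: 'r. a dvd b \<or> b dvd a"
    and card: "(UNIV :: 'r set) \<approx> (UNIV :: 'i set)"
    and rep: "represents r J"
    and Gamma: "stationary (Gamma_set r)"
  shows "\<exists>(r' :: 'i \<Rightarrow> 'r) E. represents r' J \<and> coherent_chain r' E \<and>
    (\<nexists>v. (\<forall>s. v s dvd 1) \<and> (\<forall>s t. s \<le> t \<longrightarrow> eqm (r' s) (v s) (E t s * v t)))"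
proof -
  have dvd: "r s dvd r t" if "s < t" for s t using rep that by (simp add: represents_def)
  have le_dvd: "r s dvd r t" if "s \<le> t" for s t using dvd that by (cases "s = t") auto
  have strict: "\<exists>t>s. \<not> r t dvd r s" for s by (rule stationary_Gamma_strict[OF om dvd Gamma])
  \<comment> \<open>Beyond \<open>m\<close> all generators are non-units, as
    \<open>val_chain\<close> requires.\<close>
  obtain m where m: "\<not> r m dvd 1" using strict by (meson dvd_trans one_dvd)
  have nonunit: "\<not> r s dvd 1" if "m \<le> s" for s using m le_dvd[OF that] dvd_trans by blast
  show ?thesis
  proof (cases "\<forall>s. \<exists>t>s. uncountable (rep (r t) ` {x. r s dvd x})")
    case True
    then have ex: "\<exists>t>s. uncountable (rep (r t) ` {x. r s dvd x})" for s by blast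
    have up: "uncountable (rep (r u) ` {x. r s dvd x})"
      if "uncountable (rep (r t) ` {x. r s dvd x})" "t \<le> u" for s t u
      using that(1) rep_image_dvd[OF le_dvd[OF that(2)], of "{x. r s dvd x}"] by (metis countable_image)
    obtain g :: "'i \<Rightarrow> 'i" where g: "\<And>s t. s < t \<Longrightarrow> g s < g t"
        "\<And>s t. s < t \<Longrightarrow> uncountable (rep (r (g t)) ` {x. r (g s) dvd x})" "\<And>s. m \<le> g s" "\<And>s. s \<le> g s"
      by (rule omega1_thin_out[where n = m, OF om ex]) (erule (1) up, rule that)
    have rep': "represents (\<lambda>s. r (g s)) J" by (rule represents_subchain[OF rep g(1,4)])
    interpret val_chain "\<lambda>s. r (g s)"
      by (rule val_chain_of_represents[OF tot rep' nonunit[OF g(3)]])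
    obtain E where "coherent_chain (\<lambda>s. r (g s)) E \<and>
      (\<nexists>v. (\<forall>s. v s dvd 1) \<and> (\<forall>s t. s \<le> t \<longrightarrow> eqm (r (g s)) (v s) (E t s * v t)))"
      using no_thread_uncountable[OF om g(2) no_inj card] ..
    then show ?thesis using rep' by (intro exI[of _ "\<lambda>s. r (g s)"] exI[of _ E] conjI) simp_all
  next
    case False
    then have "\<exists>n. \<forall>t>n. countable (rep (r t) ` {x. r n dvd x})" by simp
    then obtain n where "\<forall>t>n. countable (rep (r t) ` {x. r n dvd x})" ..
    then have n: "countable (rep (r t) ` {x. r n dvd x})" if "n < t" for t using that by simp
    have up: "infinite (rep (r u) ` {x. r s dvd x})"
      if "infinite (rep (r t) ` {x. r s dvd x})" "t \<le> u" for s t u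
      using that(1) rep_image_dvd[OF le_dvd[OF that(2)], of "{x. r s dvd x}"] by (metis finite_imageI)
    have ex: "\<exists>t>s. infinite (rep (r t) ` {x. r s dvd x})" for s
      by (rule infinite_step[OF om dvd strict])
    \<comment> \<open>The thinned chain starts strictly beyond \<open>n\<close>, so its first ideal
      lies in that of \<open>n\<close> and the quotients of this first ideal are countable; starting
      beyond \<open>m\<close> gives non-units.\<close>
    have "countable {m, n}" by simp
    then obtain b where b: "\<And>x. x \<in> {m, n} \<Longrightarrow> x < b" using omega1_bounded[OF om] by blast
    obtain g :: "'i \<Rightarrow> 'i" where g: "\<And>s t. s < t \<Longrightarrow> g s < g t"
        "\<And>s t. s < t \<Longrightarrow> infinite (rep (r (g t)) ` {x. r (g s) dvd x})" "\<And>s. b \<le> g s" "\<And>s. s \<le> g s"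
      by (rule omega1_thin_out[where n = b, OF om ex]) (erule (1) up, rule that)
    have gm: "m \<le> g s" "n < g s" for s using b[of m] b[of n] g(3)[of s] by auto
    have rep': "represents (\<lambda>s. r (g s)) J" by (rule represents_subchain[OF rep g(1,4)])
    interpret val_chain "\<lambda>s. r (g s)"
      by (rule val_chain_of_represents[OF tot rep' nonunit[OF gm(1)]])
    have "countable (rep (r (g d)) ` {x. r (g (LEAST s. True)) dvd x})" for d
    proof (rule countable_subset[OF image_mono n[OF gm(2)]])
      show "{x. r (g (LEAST s. True)) dvd x} \<subseteq> {x. r n dvd x}"
        using dvd[OF gm(2)] dvd_trans by blast
    qed
    then obtain E where "coherent_chain (\<lambda>s. r (g s)) E \<and>
      (\<nexists>v. (\<forall>s. v s dvd 1) \<and> (\<forall>s t. s \<le> t \<longrightarrow> eqm (r (g s)) (v s) (E t s * v t)))"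
      using no_thread_countable[OF om _ g(2)] by meson
    then show ?thesis using rep' by (intro exI[of _ "\<lambda>s. r (g s)"] exI[of _ E] conjI) simp_all
  qed
qed

theorem mainTheorem11:
  fixes r :: "'i::wellorder \<Rightarrow> 'r::idom"
    and J :: "'r fract set"
  assumes omega1: "omega1_like TYPE('i)"
    and notCH: "\<not> ((UNIV :: 'i set) \<approx> (UNIV :: real set))"
    and val: "valuation_domain TYPE('r)"
    and card: "(UNIV :: 'r set) \<approx> (UNIV :: 'i set)"
    and Jsub: "Q_submodule J" and RJ: "Rset \<subseteq> J"
    and rep: "represents r J"
    and Gamma: "stationary (Gamma_set r)"
  shows "\<exists>(M :: 'r set set) add z sm.
           uniserial M add z sm \<and> \<not> standard M add z sm \<and> has_type M add z sm J Rset"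
proof -
  obtain r' :: "'i \<Rightarrow> 'r" and E where r': "represents r' J" "coherent_chain r' E"
    "\<nexists>v. (\<forall>s. v s dvd 1) \<and> (\<forall>s t. s \<le> t \<longrightarrow> eqm (r' s) (v s) (E t s * v t))"
    using coherent_chain_without_thread[OF omega1 no_inj_of_not_CH[OF omega1 notCH card]
        valuation_dvd_total[OF val] card rep Gamma] by (elim exE conjE) (rule that)
  \<comment> \<open>An infinite ring as large as \<open>'i\<close> admits an injection of
    \<open>'i \<times> 'r\<close> into it; this encodes the module in
    \<open>'r set set\<close>.\<close>
  have "infinite (UNIV :: 'i set)" using omega1 countable_finite by (auto simp: omega1_like_def)
  then have inf: "infinite (UNIV :: 'r set)" using card eqpoll_finite_iff by blast
  have "(UNIV :: ('i \<times> 'r) set) \<lesssim> (UNIV :: ('r \<times> 'r) set)"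
    using times_lepoll_mono[OF eqpoll_imp_lepoll[OF eqpoll_sym[OF card]] lepoll_refl[of "UNIV :: 'r set"]]
    by simp
  also have "(UNIV :: ('r \<times> 'r) set) \<lesssim> (UNIV :: 'r set)"
    using card_of_Times_same_infinite[OF inf] eqpoll_iff_card_of_ordIso eqpoll_imp_lepoll
    by (metis UNIV_Times_UNIV)
  finally obtain \<phi> :: "'i \<times> 'r \<Rightarrow> 'r" where "inj \<phi>" unfolding lepoll_def by blast
  then show ?thesis
    by (rule coherent_chain.nonstandard_module_exists[OF r'(2,3) _ r'(1)])
qed

end
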